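(* For complex $s$, \[ (s-1)\zeta(s)=-\int_{0}^{1}\mathrm{Li}_{s}\!\left(\frac{z}{z-1}\right)dz, \] and, more generally, for $x$ inside the unit disk ($|x|<1$), \[ Z(s,x)=-\int_{0}^{x}\mathrm{Li}_{s}\!\left(\frac{z}{z-1}\right)dz, \] where the integrals are line integrals (along the segment from $0$ to the upper limit).
   Context: $\zeta$ is the Riemann zeta function. For $n\ge1$ and $s\in\mathbb{C}$, $S_n(s)=\sum_{k=0}^{n-1}(-1)^k\binom{n-1}{k}(k+1)^{-s}$. For $|x|<1$, $Z(s,x)=\sum_{n=1}^{\infty}\frac{S_n(s)}{n+1}x^{n+1}$. $\mathrm{Li}_s(w)$ is the polylogarithm, $\mathrm{Li}_s(w)=\sum_{n\ge1}w^n/n^s$ for $|w|<1$, extended (principal branch) by analytic continuation to $w\in\mathbb{C}\setminus[1,\infty)$; note $w=z/(z-1)\in\mathbb{C}\setminus[1,\infty)$ exactly when $z\notin[1,\infty)$. *)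

theory Defs
  imports "HOL-Complex_Analysis.Complex_Analysis"
begin

text \<open>
  The Riemann zeta function is the analytic continuation of its Dirichlet series to the
  punctured plane. The conditions determine it uniquely except at the pole \<open>1\<close>, where its
  value is unspecified.
\<close>
definition riemann_zeta :: "complex \<Rightarrow> complex" where
  "riemann_zeta = (SOME f. f holomorphic_on (- {1}) \<and>
     (\<forall>s. 1 < Re s \<longrightarrow> (\<lambda>n. 1 / of_nat (Suc n) powr s) sums f s))"

text \<open>
  For each \<open>s\<close>, the principal branch of the polylogarithm is the analytic continuation of its
  power series to the plane cut along \<open>[1, \<infinity>)\<close>. This domain is connected, so the conditions
  determine the function uniquely there; its values on the cut are unspecified.
\<close>
definition polylog :: "complex \<Rightarrow> complex \<Rightarrow> complex" where
  "polylog s = (SOME f. f holomorphic_on (- (complex_of_real ` {1..})) \<and>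
     (\<forall>w. norm w < 1 \<longrightarrow> (\<lambda>n. w ^ Suc n / of_nat (Suc n) powr s) sums f w))"

text \<open>Intended for \<open>n \<ge> 1\<close>.\<close>
definition S :: "nat \<Rightarrow> complex \<Rightarrow> complex" where
  "S n s = (\<Sum>k = 0..n - 1. (- 1) ^ k * of_nat ((n - 1) choose k) * of_nat (k + 1) powr (- s))"

text \<open>The summation index is shifted by one: \<open>n\<close> here stands for \<open>n - 1\<close> in the series over \<open>n \<ge> 1\<close>.\<close>
definition Z_term :: "complex \<Rightarrow> complex \<Rightarrow> nat \<Rightarrow> complex" where
  "Z_term s x n = S (Suc n) s / of_nat (Suc n + 1) * x ^ (Suc n + 1)"

definition Z :: "complex \<Rightarrow> complex \<Rightarrow> complex" where
  "Z s x = (\<Sum>n. Z_term s x n)"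

end

theory Submission
  imports Defs
begin

text \<open>
  Put \<open>F s z = - Li\<^sub>s (z / (z - 1))\<close>. For \<open>Re s > 1\<close> the Gamma integral gives
  \<open>\<Gamma>(s) F s z = \<integral>\<^sub>0\<^sup>\<infinity> t\<^bsup>s-1\<^esup> K(t, z) dt\<close> with
  \<open>K(t, z) = z e\<^bsup>-t\<^esup> / (1 - z (1 - e\<^bsup>-t\<^esup>))\<close>, and
  \<open>\<integral>\<^sub>0\<^sup>1 K(t, z) dz = \<Sum>\<^sub>n (n t - 1) e\<^bsup>-nt\<^esup>\<close>, so termwise integration yields
  \<open>\<integral>\<^sub>0\<^sup>1 F s z dz = (s - 1) \<Sum>\<^sub>n n\<^bsup>-s\<^esup>\<close>.

  All other \<open>s\<close> are reached through \<open>F (s - 1) z = z (1 - z) F' s z\<close>, the image of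
  \<open>Li\<^bsub>s-1\<^esub>(w) = w Li\<^sub>s'(w)\<close>. It continues the polylogarithm to every order, and integration by parts
  turns \<open>\<integral>\<^sub>0\<^sup>1 p F (s - 1)\<close> into \<open>- \<integral>\<^sub>0\<^sup>1 (p z (1 - z))' F s\<close> for polynomials \<open>p\<close>; the boundary term
  at \<open>1\<close> vanishes because \<open>F s z = O((1 - z)\<^bsup>-1/2\<^esup>)\<close>. Hence \<open>\<integral>\<^sub>0\<^sup>1 p F s\<close> is an entire function of
  \<open>s\<close>, which for \<open>p = 1\<close> must be \<open>(s - 1) \<zeta>(s)\<close>.

  Inside the unit disk, the Taylor coefficients of \<open>F s\<close> at \<open>0\<close> are the \<open>S n s\<close>, and the power series is
  integrated termwise.
\<close>

subsection \<open>Parameter-dependent and Gamma integrals\<close>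

text \<open>Local domination of \<open>f\<close> alone suffices. Cauchy's estimate turns the bound
  \<open>g\<close> on a disk into the bound \<open>g / r\<close> for the derivative in
  \<open>s\<close> on a smaller disk, hence for the difference quotients, and dominated convergence
  then allows differentiation under the integral sign.\<close>

lemma holomorphic_on_lebesgue_integral:
  fixes f :: "complex \<Rightarrow> 'a \<Rightarrow> complex"
  assumes "open U"
    and hol: "\<And>t. t \<in> space M \<Longrightarrow> (\<lambda>s. f s t) holomorphic_on U"
    and meas: "\<And>s. s \<in> U \<Longrightarrow> f s \<in> borel_measurable M"
    and dom: "\<And>a. a \<in> U \<Longrightarrow> \<exists>r>0. \<exists>g. integrable M g \<and>
                (\<forall>s\<in>ball a r \<inter> U. \<forall>t\<in>space M. norm (f s t) \<le> g t)"
  shows "(\<lambda>s. \<integral>t. f s t \<partial>M) holomorphic_on U"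
  unfolding holomorphic_on_open[OF \<open>open U\<close>]
proof
  fix a assume a: "a \<in> U"
  obtain r0 g where r0: "r0 > 0" and g: "integrable M g"
    and bound0: "\<And>s t. s \<in> ball a r0 \<inter> U \<Longrightarrow> t \<in> space M \<Longrightarrow> norm (f s t) \<le> g t"
    using dom[OF a] by blast
  obtain r1 where r1: "r1 > 0" "ball a r1 \<subseteq> U"
    using \<open>open U\<close> a by (auto simp: open_contains_ball)
  \<comment> \<open>The factor 2 leaves room for circles of radius \<open>r\<close> around every
    point of \<open>ball a r\<close>.\<close>
  define r where "r = min r0 r1 / 2"
  have r: "r > 0" "ball a (2 * r) \<subseteq> U" "ball a (2 * r) \<subseteq> ball a r0"
    using r0 r1 by (auto simp: r_def)
  have bound: "norm (f s t) \<le> g t" if "s \<in> ball a (2 * r)" "t \<in> space M" for s t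
    using bound0[of s t] that r by blast
  have deriv_bound: "norm (deriv (\<lambda>s. f s t) z) \<le> g t / r"
    if z: "z \<in> ball a r" and t: "t \<in> space M" for z t
  proof -
    have sub: "cball z r \<subseteq> ball a (2 * r)"
    proof
      fix y assume "y \<in> cball z r"
      hence "dist z y \<le> r" "dist a z < r" using z by auto
      thus "y \<in> ball a (2 * r)" using dist_triangle[of a y z] by auto
    qed
    have "norm ((deriv ^^ 1) (\<lambda>s. f s t) z) \<le> fact 1 * g t / r ^ 1"
    proof (rule Cauchy_inequality)
      have h: "(\<lambda>s. f s t) holomorphic_on cball z r"
        using hol[OF t] sub r(2) by (auto elim!: holomorphic_on_subset)
      thus "continuous_on (cball z r) (\<lambda>s. f s t)" by (rule holomorphic_on_imp_continuous_on)
      show "(\<lambda>s. f s t) holomorphic_on ball z r" using h by (rule holomorphic_on_subset) auto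
      show "norm (f x t) \<le> g t" if "norm (z - x) = r" for x
        using sub that by (intro bound t) (auto simp: dist_norm subset_eq)
    qed (use r in auto)
    thus ?thesis by simp
  qed
  have quot: "norm ((f y t - f a t) / (y - a)) \<le> g t / r"
    if y: "y \<in> ball a r" "y \<noteq> a" and t: "t \<in> space M" for y t
  proof -
    have "norm (f y t - f a t) \<le> g t / r * norm (y - a)"
    proof (rule field_differentiable_bound[of "ball a r" _ "\<lambda>z. deriv (\<lambda>s. f s t) z"])
      show "((\<lambda>s. f s t) has_field_derivative deriv (\<lambda>s. f s t) z) (at z within ball a r)"
        if "z \<in> ball a r" for z
        using that r by (intro holomorphic_derivI[OF hol[OF t] \<open>open U\<close>]) auto
    qed (use y r deriv_bound t in auto)
    thus ?thesis using y by (simp add: norm_divide divide_le_eq)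
  qed
  have "((\<lambda>s. \<integral>t. f s t \<partial>M) has_field_derivative (\<integral>t. deriv (\<lambda>s. f s t) a \<partial>M)) (at a)"
    unfolding has_field_derivative_iff tendsto_at_iff_sequentially
  proof safe
    fix X :: "nat \<Rightarrow> complex" assume X: "\<forall>i. X i \<in> UNIV - {a}" and lim: "X \<longlonglongrightarrow> a"
    obtain k where k: "\<And>n. n \<ge> k \<Longrightarrow> X n \<in> ball a r"
      using topological_tendstoD[OF lim, of "ball a r"] r by (auto simp: eventually_sequentially)
    \<comment> \<open>Dominated convergence asks for the bound at every index, so the finitely many
      terms that may lie outside the disk are dropped.\<close>
    define Y where "Y n = X (n + k)" for n
    have Y: "Y n \<in> ball a r" "Y n \<noteq> a" "Y n \<in> U" for n
      using k[of "n + k"] X r by (auto simp: Y_def)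
    have Ylim: "Y \<longlonglongrightarrow> a" unfolding Y_def using lim by (rule LIMSEQ_ignore_initial_segment)
    have pointwise: "(\<lambda>n. (f (Y n) t - f a t) / (Y n - a)) \<longlonglongrightarrow> deriv (\<lambda>s. f s t) a"
      if t: "t \<in> space M" for t
    proof -
      have "((\<lambda>s. f s t) has_field_derivative deriv (\<lambda>s. f s t) a) (at a)"
        by (rule holomorphic_derivI[OF hol[OF t] \<open>open U\<close> a])
      thus ?thesis
        using Y(2) Ylim
        unfolding has_field_derivative_iff tendsto_at_iff_sequentially by (auto simp: o_def)
    qed
    have Ymeas: "(\<lambda>t. (f (Y n) t - f a t) / (Y n - a)) \<in> borel_measurable M" for n
      using meas[OF Y(3)[of n]] meas[OF a] by measurable
    have "(\<lambda>n. \<integral>t. (f (Y n) t - f a t) / (Y n - a) \<partial>M) \<longlonglongrightarrow> (\<integral>t. deriv (\<lambda>s. f s t) a \<partial>M)"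
    proof (rule integral_dominated_convergence[where w = "\<lambda>t. g t / r"])
      show "(\<lambda>t. deriv (\<lambda>s. f s t) a) \<in> borel_measurable M"
        by (rule borel_measurable_LIMSEQ_metric[OF Ymeas pointwise])
      show "AE t in M. norm ((f (Y n) t - f a t) / (Y n - a)) \<le> g t / r" for n
        using quot[OF Y(1,2)] by (intro AE_I2) auto
    qed (use g Ymeas pointwise in auto)
    also have "(\<lambda>n. \<integral>t. (f (Y n) t - f a t) / (Y n - a) \<partial>M) =
       (\<lambda>n. ((\<integral>t. f (Y n) t \<partial>M) - (\<integral>t. f a t \<partial>M)) / (Y n - a))"
    proof
      fix n
      have "integrable M (f s)" if "s \<in> ball a r" for s
      proof (rule Bochner_Integration.integrable_bound[OF g])
        show "f s \<in> borel_measurable M" using that r by (intro meas) auto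
        show "AE t in M. norm (f s t) \<le> norm (g t)"
          using bound[of s] that r by (intro AE_I2) (force intro: order.trans[OF _ abs_ge_self])
      qed
      from this[OF Y(1)[of n]] this[of a] r
      show "(\<integral>t. (f (Y n) t - f a t) / (Y n - a) \<partial>M) =
        ((\<integral>t. f (Y n) t \<partial>M) - (\<integral>t. f a t \<partial>M)) / (Y n - a)" by simp
    qed
    finally show "((\<lambda>y. ((\<integral>t. f y t \<partial>M) - (\<integral>t. f a t \<partial>M)) / (y - a)) \<circ> X)
      \<longlonglongrightarrow> (\<integral>t. deriv (\<lambda>s. f s t) a \<partial>M)"
      unfolding Y_def o_def by (rule LIMSEQ_offset)
  qed
  thus "\<exists>f'. ((\<lambda>s. \<integral>t. f s t \<partial>M) has_field_derivative f') (at a)" by blast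
qed

section \<open>Gamma integrals over the positive half-line\<close>

abbreviation halfline :: "real measure" where
  "halfline \<equiv> restrict_space lborel {0<..}"

lemma borel_measurable_halfline:
  "continuous_on {0<..} f \<Longrightarrow> f \<in> borel_measurable halfline"
  for f :: "real \<Rightarrow> 'b::topological_space"
  using borel_measurable_continuous_on_restrict[of "{0<..}" f]
  by (simp cong: measurable_cong_sets add: sets_restrict_space)

text \<open>For \<open>c = 1\<close> this is Euler's integral; absolute integrability lets the gauge
  integral be read as a Lebesgue integral. The substitution of \<open>c * t\<close> for
  \<open>t\<close> gives the general case.\<close>

lemma has_bochner_integral_Gamma:
  assumes s: "Re s > 0" and c: "c > 0"
  shows "has_bochner_integral halfline
           (\<lambda>t. of_real t powr (s - 1) * of_real (exp (- (c * t)))) (Gamma s / of_real c powr s)"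
proof -
  define f where "f t = indicator {0<..} t *\<^sub>R (of_real t powr (s - 1) * complex_of_real (exp (- t)))" for t :: real
  have eq: "of_real t powr (s - 1) * complex_of_real (exp (- t)) = of_real t powr (s - 1) / of_real (exp t)" for t
    by (simp add: exp_minus divide_inverse)
  have meas: "f \<in> borel_measurable borel"
    unfolding f_def by (intro borel_measurable_continuous_on_indicator) (auto intro!: continuous_intros)
  have "integrable lebesgue f"
    using absolutely_integrable_Gamma_integral'[OF s] unfolding f_def eq set_integrable_def .
  hence int: "integrable lborel f"
    using meas by (simp add: integrable_completion)
  have "integral\<^sup>L lborel f = integral {0<..} (\<lambda>t. of_real t powr (s - 1) / of_real (exp t))"
    using set_borel_integral_eq_integral(2)[of "{0<..}" "\<lambda>t. of_real t powr (s - 1) / complex_of_real (exp t)"] int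
    unfolding f_def set_lebesgue_integral_def set_integrable_def eq by simp
  also have "\<dots> = Gamma s"
    using Gamma_integral_complex'[OF s] by (rule integral_unique)
  finally have "has_bochner_integral lborel f (Gamma s)"
    using int by (simp add: has_bochner_integral_iff)
  hence "has_bochner_integral lborel (\<lambda>t. f (0 + c * t)) (Gamma s /\<^sub>R \<bar>c\<bar>)"
    using c by (subst (asm) lborel_has_bochner_integral_real_affine_iff[where t = 0 and c = c]) auto
  \<comment> \<open>For positive \<open>c\<close> and \<open>t\<close> the power of
    \<open>c * t\<close> splits into a product. The Jacobian contributes \<open>1 / c\<close>, and
    the constant factor \<open>c powr (s - 1)\<close> is divided out.\<close>
  hence "has_bochner_integral lborel (\<lambda>t. f (0 + c * t) / of_real c powr (s - 1))
            ((Gamma s /\<^sub>R \<bar>c\<bar>) / of_real c powr (s - 1))"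
    by (rule has_bochner_integral_divide_zero)
  also have "(\<lambda>t. f (0 + c * t) / of_real c powr (s - 1)) =
     (\<lambda>t. indicator {0<..} t *\<^sub>R (of_real t powr (s - 1) * complex_of_real (exp (- (c * t)))))"
    using c by (auto simp: f_def fun_eq_iff indicator_def zero_less_mult_iff powr_times_real)
  also have "(Gamma s /\<^sub>R \<bar>c\<bar>) / of_real c powr (s - 1) = Gamma s / of_real c powr s"
    using c by (simp add: powr_diff scaleR_conv_of_real field_simps)
  finally show ?thesis
    by (simp add: has_bochner_integral_iff integral_restrict_space integrable_restrict_space)
qed

lemma norm_of_real_powr:
  "t > 0 \<Longrightarrow> norm (complex_of_real t powr s) = t powr Re s"
  by (simp add: norm_powr_real_powr)

lemma has_bochner_integral_Gamma_real:
  assumes a: "a > 0" and c: "c > 0"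
  shows "has_bochner_integral halfline (\<lambda>t. t powr (a - 1) * exp (- (c * t))) (Gamma a / c powr a)"
proof -
  have "has_bochner_integral halfline (\<lambda>t. complex_of_real (t powr (a - 1) * exp (- (c * t)))) 
          (complex_of_real (Gamma a / c powr a))"
  proof (rule has_bochner_integral_cong[THEN iffD1, OF refl _ _ has_bochner_integral_Gamma[of "of_real a" c]])
    show "complex_of_real t powr (of_real a - 1) * of_real (exp (- (c * t))) =
            of_real (t powr (a - 1) * exp (- (c * t)))" if "t \<in> space halfline" for t
      using that powr_of_real[of t "a - 1"] by (simp add: space_restrict_space)
  qed (use assms in \<open>auto simp: Gamma_complex_of_real powr_of_real\<close>)
  from has_bochner_integral_bounded_linear[OF bounded_linear_Re this] show ?thesis by simp
qed

subsection \<open>Analytic continuation of the polylogarithm\<close>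

definition slit_plane :: "complex set" where
  "slit_plane = - (complex_of_real ` {1..})"

lemma open_slit_plane: "open slit_plane"
proof -
  have "complex_of_real ` {1..} = {z. Im z = 0} \<inter> {z. Re z \<ge> 1}"
    by (auto simp: image_iff complex_eq_iff)
  also have "closed \<dots>"
    by (intro closed_Int closed_Collect_eq closed_Collect_le continuous_intros)
  finally have "closed (complex_of_real ` {1..})" .
  thus ?thesis by (simp add: slit_plane_def open_Compl)
qed

text \<open>Dividing a point of the cut by some \<open>x\<close> in (0, 1] stays on the cut, so
  contraction towards 0 cannot move a point onto it.\<close>

lemma starlike_slit_plane:
  assumes "w \<in> slit_plane" "x \<in> {0..1}"
  shows "of_real x * w \<in> slit_plane"
proof (rule ccontr)
  assume "of_real x * w \<notin> slit_plane"
  then obtain y where y: "of_real x * w = of_real y" "y \<ge> 1" by (auto simp: slit_plane_def)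
  hence "x > 0" using assms(2) by (cases "x = 0") auto
  with y have "w = of_real (y / x)" by (simp add: field_simps)
  moreover have "y / x \<ge> 1" using y assms \<open>x > 0\<close> by (simp add: field_simps)
  ultimately show False using assms(1) unfolding slit_plane_def by blast
qed

lemma connected_slit_plane: "connected slit_plane"
proof (rule starlike_imp_connected)
  show "starlike slit_plane" unfolding starlike_def
  proof (rule bexI[of _ 0])
    show "\<forall>w\<in>slit_plane. closed_segment 0 w \<subseteq> slit_plane"
      using starlike_slit_plane by (auto simp: closed_segment_def scaleR_conv_of_real)
  qed (auto simp: slit_plane_def)
qed

lemma ball_subset_slit_plane: "ball 0 1 \<subseteq> slit_plane"
  by (auto simp: slit_plane_def)

lemma slit_plane_denominator_nonzero:
  assumes "w \<in> slit_plane" "x \<in> {0..1}"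
  shows "1 - w * of_real x \<noteq> 0"
proof
  assume "1 - w * of_real x = 0"
  hence "of_real x * w = of_real 1" by (simp add: mult.commute)
  with starlike_slit_plane[OF assms] show False by (auto simp: slit_plane_def)
qed

text \<open>The condition by which \<open>polylog\<close> is chosen, as a predicate of its own:
  existence is shown by exhibiting candidates, and any two candidates agree on
  \<open>slit_plane\<close> by the identity theorem.\<close>

definition polylog_continuation :: "complex \<Rightarrow> (complex \<Rightarrow> complex) \<Rightarrow> bool" where
  "polylog_continuation s f \<longleftrightarrow> f holomorphic_on slit_plane \<and>
     (\<forall>w. norm w < 1 \<longrightarrow> (\<lambda>n. w ^ Suc n / of_nat (Suc n) powr s) sums f w)"

lemma polylog_continuation_unique:
  assumes f: "polylog_continuation s f" and g: "polylog_continuation s g" and w: "w \<in> slit_plane"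
  shows "f w = g w"
proof (rule analytic_continuation_open[of "ball 0 1" slit_plane f g])
  show "f z = g z" if "z \<in> ball 0 1" for z
    using f g that sums_unique2 unfolding polylog_continuation_def by (metis mem_ball_0)
qed (use f g w in \<open>auto simp: polylog_continuation_def open_slit_plane connected_slit_plane
       ball_subset_slit_plane[THEN subsetD]\<close>)

text \<open>The Bose-Einstein integral of t^(s-1) / (e^t / w - 1), arranged so that
  \<open>w = 0\<close> is harmless.\<close>

definition polylog_integral :: "complex \<Rightarrow> complex \<Rightarrow> complex" where
  "polylog_integral s w = (\<integral>t. of_real t powr (s - 1) *
     (w * of_real (exp (- t)) / (1 - w * of_real (exp (- t)))) \<partial>halfline) / Gamma s"

text \<open>Holomorphy follows from local domination. In the unit disk the integrand is a geometric
  series in w e^(-t), and each of its terms is a Gamma integral.\<close>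

lemma polylog_integral_continuation:
  assumes s: "Re s > 1"
  shows "polylog_continuation s (polylog_integral s)"
  unfolding polylog_continuation_def
proof (intro conjI allI impI)
  define f where "f w t = of_real t powr (s - 1) *
     (w * of_real (exp (- t)) / (1 - w * of_real (exp (- t))))" for w and t :: real
  have G: "Gamma s \<noteq> 0" using s by (auto simp: Gamma_eq_zero_iff elim!: nonpos_Ints_cases)
  have nz: "1 - w * complex_of_real (exp (- t)) \<noteq> 0" if "w \<in> slit_plane" "t > 0" for w t
    using that by (intro slit_plane_denominator_nonzero) auto
  have "(\<lambda>w. \<integral>t. f w t \<partial>halfline) holomorphic_on slit_plane"
  proof (rule holomorphic_on_lebesgue_integral[OF open_slit_plane])
    show "(\<lambda>w. f w t) holomorphic_on slit_plane" if "t \<in> space halfline" for t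
      using that nz unfolding f_def by (auto intro!: holomorphic_intros simp: space_restrict_space)
    show "f w \<in> borel_measurable halfline" if "w \<in> slit_plane" for w
      unfolding f_def using that nz
      by (intro borel_measurable_halfline) (auto intro!: continuous_intros)
    fix a assume a: "a \<in> slit_plane"
    obtain r where r: "r > 0" "cball a r \<subseteq> slit_plane"
      using open_slit_plane a by (auto simp: open_contains_cball)
    \<comment> \<open>With \<open>exp (- t)\<close> replaced by a variable ranging over the compact
      interval \<open>{0..1}\<close>, the denominator attains a positive minimum. This bounds it
      from below uniformly in \<open>t\<close> and in \<open>w\<close> near
      \<open>a\<close>.\<close>
    have "compact (cball a r \<times> {0..1::real})" by (intro compact_Times) auto
    moreover have "continuous_on (cball a r \<times> {0..1::real}) (\<lambda>p. norm (1 - fst p * of_real (snd p)))"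
      by (intro continuous_intros)
    ultimately obtain p where p: "p \<in> cball a r \<times> {0..1}"
      "\<And>q. q \<in> cball a r \<times> {0..1} \<Longrightarrow> norm (1 - fst p * of_real (snd p)) \<le> norm (1 - fst q * of_real (snd q))"
      using continuous_attains_inf[of "cball a r \<times> {0..1::real}" "\<lambda>p. norm (1 - fst p * of_real (snd p))"] r(1)
      by force
    define m where "m = norm (1 - fst p * of_real (snd p))"
    have m: "m > 0" "\<And>w x. w \<in> cball a r \<Longrightarrow> x \<in> {0..1} \<Longrightarrow> m \<le> norm (1 - w * of_real x)"
      using p slit_plane_denominator_nonzero[of "fst p" "snd p"] r(2)
      by (auto simp: m_def mem_Times_iff)
    define g where "g t = (norm a + r) / m * (t powr (Re s - 1) * exp (- (1 * t)))" for t
    show "\<exists>r>0. \<exists>g. integrable halfline g \<and>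
           (\<forall>s\<in>ball a r \<inter> slit_plane. \<forall>t\<in>space halfline. norm (f s t) \<le> g t)"
    proof (rule exI[of _ r], intro conjI exI[of _ g] ballI)
      show "integrable halfline g"
        unfolding g_def using has_bochner_integral_Gamma_real[of "Re s" 1] s
        by (intro integrable_mult_right) (auto simp: has_bochner_integral_iff)
      fix w t assume w: "w \<in> ball a r \<inter> slit_plane" and "t \<in> space halfline"
      hence t: "t > 0" by (auto simp: space_restrict_space)
      have "norm w \<le> norm a + r" using w norm_triangle_ineq2[of w a]
        by (auto simp: dist_norm norm_minus_commute)
      moreover have "m \<le> norm (1 - w * of_real (exp (- t)))"
        using w t by (intro m(2)) auto
      ultimately have "norm w * exp (- t) / norm (1 - w * of_real (exp (- t))) \<le> (norm a + r) * exp (- t) / m"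
        using m(1) r(1) by (intro frac_le mult_right_mono mult_nonneg_nonneg) auto
      hence "t powr (Re s - 1) * (norm w * exp (- t) / norm (1 - w * of_real (exp (- t)))) \<le>
             t powr (Re s - 1) * ((norm a + r) * exp (- t) / m)"
        by (intro mult_left_mono) auto
      thus "norm (f w t) \<le> g t"
        using t by (simp add: f_def g_def norm_mult norm_divide norm_of_real_powr mult_ac)
    qed (use r in auto)
  qed
  thus "polylog_integral s holomorphic_on slit_plane"
    unfolding polylog_integral_def f_def using G by (intro holomorphic_intros) auto

  fix w :: complex assume w: "norm w < 1"
  define u where "u n t = w ^ Suc n * (of_real t powr (s - 1) * of_real (exp (- (real (Suc n) * t))))" for n and t :: real
  have u: "has_bochner_integral halfline (u n) (w ^ Suc n * (Gamma s / of_nat (Suc n) powr s))" for n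
    unfolding u_def using has_bochner_integral_Gamma[of s "real (Suc n)"] s
    by (intro has_bochner_integral_mult_right) auto
  have u_eq: "u n t = of_real t powr (s - 1) * (w * of_real (exp (- t))) * (w * of_real (exp (- t))) ^ n" for n t
  proof -
    have "exp (- (real (Suc n) * t)) = exp (- t) ^ Suc n"
      by (subst exp_of_nat_mult[symmetric]) simp
    thus ?thesis by (simp add: u_def power_mult_distrib mult_ac)
  qed
  have lt: "norm (w * of_real (exp (- t))) < 1" if "t > 0" for t
  proof -
    have "norm w * exp (- t) \<le> norm w * 1" using that by (intro mult_left_mono) auto
    thus ?thesis using w by (simp add: norm_mult)
  qed
  have sm: "(\<lambda>n. u n t) sums f w t" if "t > 0" for t
    using sums_mult[OF geometric_sums[OF lt[OF that]], of "of_real t powr (s - 1) * (w * of_real (exp (- t)))"]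
    unfolding u_eq f_def by (simp add: mult_ac)
  have "(\<lambda>n. integral\<^sup>L halfline (u n)) sums (\<integral>t. (\<Sum>n. u n t) \<partial>halfline)"
  proof (rule sums_integral)
    show "integrable halfline (u n)" for n using u by (auto simp: has_bochner_integral_iff)
    show "AE t in halfline. summable (\<lambda>n. norm (u n t))"
    proof (rule AE_I2)
      fix t assume "t \<in> space halfline"
      hence "t > 0" by (auto simp: space_restrict_space)
      thus "summable (\<lambda>n. norm (u n t))"
        unfolding u_eq norm_mult norm_power using lt[of t]
        by (intro summable_mult summable_geometric) (auto simp: norm_mult)
    qed
    have n: "(\<integral>t. norm (u n t) \<partial>halfline) \<le> norm w ^ n * Gamma (Re s)" for n
    proof -
      have "(\<integral>t. norm (u n t) \<partial>halfline) = 
          (\<integral>t. norm w ^ Suc n * (t powr (Re s - 1) * exp (- (real (Suc n) * t))) \<partial>halfline)"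
        by (intro Bochner_Integration.integral_cong)
          (auto simp: space_restrict_space u_def norm_mult norm_power norm_of_real_powr)
      also have "\<dots> = norm w ^ Suc n * (Gamma (Re s) / real (Suc n) powr Re s)"
        using has_bochner_integral_Gamma_real[of "Re s" "real (Suc n)"] s
        by (simp add: has_bochner_integral_iff)
      \<comment> \<open>Bounding the power of \<open>Suc n\<close> from below by 1 leaves a
        geometric majorant.\<close>
      also have "\<dots> \<le> norm w ^ n * (Gamma (Re s) / 1)"
        using s w by (intro mult_mono power_decreasing divide_left_mono)
          (auto intro!: ge_one_powr_ge_zero less_imp_le[OF Gamma_real_pos])
      finally show ?thesis by simp
    qed
    show "summable (\<lambda>n. \<integral>t. norm (u n t) \<partial>halfline)"
      by (rule summable_comparison_test'[of "\<lambda>n. norm w ^ n * Gamma (Re s)" 0])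
        (use n w in \<open>auto intro!: summable_mult2 summable_geometric\<close>)
  qed
  also have "(\<integral>t. (\<Sum>n. u n t) \<partial>halfline) = (\<integral>t. f w t \<partial>halfline)"
    using sums_unique[OF sm] by (intro Bochner_Integration.integral_cong) (auto simp: space_restrict_space)
  also have "(\<lambda>n. integral\<^sup>L halfline (u n)) = (\<lambda>n. w ^ Suc n * (Gamma s / of_nat (Suc n) powr s))"
    using u by (auto simp: has_bochner_integral_iff)
  finally have "(\<lambda>n. w ^ Suc n * (Gamma s / of_nat (Suc n) powr s) / Gamma s) sums
                  ((\<integral>t. f w t \<partial>halfline) / Gamma s)"
    by (rule sums_divide)
  thus "(\<lambda>n. w ^ Suc n / of_nat (Suc n) powr s) sums polylog_integral s w"
    using G by (simp add: polylog_integral_def f_def)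
qed

text \<open>The operator w d/dw multiplies the n-th coefficient by n, which lowers the order by one,
  and it preserves holomorphy on the cut plane.\<close>

lemma polylog_continuation_diff_1:
  assumes f: "polylog_continuation s f"
  shows "polylog_continuation (s - 1) (\<lambda>w. w * deriv f w)"
  unfolding polylog_continuation_def
proof (intro conjI allI impI)
  have hol: "f holomorphic_on slit_plane" using f by (simp add: polylog_continuation_def)
  thus "(\<lambda>w. w * deriv f w) holomorphic_on slit_plane"
    using open_slit_plane by (intro holomorphic_intros)
  fix w :: complex assume w: "norm w < 1"
  define c where "c n = (if n = 0 then 0 else 1 / of_nat n powr s :: complex)" for n
  have "(\<lambda>n. diffs c n * w ^ n) sums deriv f w"
  proof (rule termdiffs_sums_strong[OF _ _ w])
    show "(\<lambda>n. c n * z ^ n) sums f z" if "norm z < 1" for z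
    proof -
      have "(\<lambda>n. c (Suc n) * z ^ Suc n) sums f z"
        using f that by (simp add: polylog_continuation_def c_def)
      thus ?thesis by (subst (asm) sums_Suc_iff) (simp add: c_def)
    qed
    show "(f has_field_derivative deriv f w) (at w)"
      using w ball_subset_slit_plane by (intro holomorphic_derivI[OF hol open_slit_plane]) auto
  qed
  hence "(\<lambda>n. w * (diffs c n * w ^ n)) sums (w * deriv f w)" by (rule sums_mult)
  also have "(\<lambda>n. w * (diffs c n * w ^ n)) = (\<lambda>n. w ^ Suc n / of_nat (Suc n) powr (s - 1))"
    by (auto simp: diffs_def c_def powr_diff fun_eq_iff simp del: of_nat_Suc)
  finally show "(\<lambda>n. w ^ Suc n / of_nat (Suc n) powr (s - 1)) sums (w * deriv f w)" .
qed

text \<open>Starting from the integral for \<open>Re s > 1\<close>, each use of w d/dw moves the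
  half plane of admissible orders one unit to the left.\<close>

lemma ex_polylog_continuation: "\<exists>f. polylog_continuation s f"
proof -
  have "\<exists>f. polylog_continuation s f" if "Re s > 1 - real N" for N s
    using that
  proof (induction N arbitrary: s)
    case 0
    thus ?case using polylog_integral_continuation by auto
  next
    case (Suc N)
    then obtain f where "polylog_continuation (s + 1) f" by fastforce
    from polylog_continuation_diff_1[OF this] show ?case by auto
  qed
  moreover obtain N :: nat where "real N > 1 - Re s" using reals_Archimedean2 by blast
  ultimately show ?thesis by (metis add.commute diff_less_eq less_diff_eq)
qed

lemma polylog_continuation_polylog: "polylog_continuation s (polylog s)"
  using someI_ex[OF ex_polylog_continuation[of s]]
  unfolding polylog_def polylog_continuation_def slit_plane_def .

lemma polylog_eq_integral:
  "Re s > 1 \<Longrightarrow> w \<in> slit_plane \<Longrightarrow> polylog s w = polylog_integral s w"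
  by (rule polylog_continuation_unique[OF polylog_continuation_polylog polylog_integral_continuation])

lemma polylog_diff_1:
  "w \<in> slit_plane \<Longrightarrow> polylog (s - 1) w = w * deriv (polylog s) w"
  using polylog_continuation_unique[OF polylog_continuation_polylog
     polylog_continuation_diff_1[OF polylog_continuation_polylog[of s]]] by simp

lemma holomorphic_on_polylog: "polylog s holomorphic_on slit_plane"
  using polylog_continuation_polylog by (simp add: polylog_continuation_def)

subsection \<open>The polylogarithm at \<open>z / (z - 1)\<close>\<close>

text \<open>The map z / (z - 1) is its own inverse, sends reals above 1 to reals above 1, and never
  takes the value 1. A value on the cut would therefore force \<open>z\<close> onto the cut.\<close>

lemma moebius_slit_plane:
  assumes "z \<in> slit_plane"
  shows "z - 1 \<noteq> 0" "z / (z - 1) \<in> slit_plane"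
proof -
  have "z \<noteq> of_real 1" using assms unfolding slit_plane_def by blast
  thus nz: "z - 1 \<noteq> 0" by simp
  show "z / (z - 1) \<in> slit_plane"
  proof (rule ccontr)
    assume "z / (z - 1) \<notin> slit_plane"
    then obtain y where y: "z / (z - 1) = of_real y" "y \<ge> 1" by (auto simp: slit_plane_def)
    hence eq: "z * of_real (y - 1) = of_real y" using nz by (simp add: field_simps)
    hence "y \<noteq> 1" by auto
    with y have "y > 1" by simp
    with eq have "z = of_real (y / (y - 1))" by (simp add: field_simps)
    moreover have "y / (y - 1) \<ge> 1" using \<open>y > 1\<close> by simp
    ultimately show False using assms unfolding slit_plane_def by blast
  qed
qed

text \<open>\<open>F s\<close> of the overview. The minus sign makes its Taylor coefficients at 0
  equal to the sums \<open>S n s\<close>.\<close>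

definition polylog_moebius :: "complex \<Rightarrow> complex \<Rightarrow> complex" where
  "polylog_moebius s z = - polylog s (z / (z - 1))"

lemma has_field_derivative_polylog_moebius:
  assumes z: "z \<in> slit_plane"
  shows "(polylog_moebius s has_field_derivative deriv (polylog s) (z / (z - 1)) / (z - 1)\<^sup>2) (at z)"
proof -
  note m = moebius_slit_plane[OF z]
  have "((\<lambda>z. z / (z - 1)) has_field_derivative - 1 / (z - 1)\<^sup>2) (at z)"
    using m(1) by (auto intro!: derivative_eq_intros simp: power2_eq_square divide_simps)
  moreover have "(polylog s has_field_derivative deriv (polylog s) (z / (z - 1))) (at (z / (z - 1)))"
    using m(2) by (intro holomorphic_derivI[OF holomorphic_on_polylog open_slit_plane])
  ultimately have "((\<lambda>z. polylog s (z / (z - 1))) has_field_derivative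
      deriv (polylog s) (z / (z - 1)) * (- 1 / (z - 1)\<^sup>2)) (at z)"
    by (rule DERIV_chain2[rotated])
  from DERIV_minus[OF this] show ?thesis by (simp add: polylog_moebius_def[abs_def])
qed

lemma holomorphic_on_polylog_moebius: "polylog_moebius s holomorphic_on slit_plane"
  using has_field_derivative_polylog_moebius open_slit_plane
  by (auto simp: holomorphic_on_open)

text \<open>For w = z / (z - 1) one has dw/dz = -1 / (z - 1)^2, so w d/dw becomes z (1 - z)
  d/dz.\<close>

lemma polylog_moebius_diff_1:
  assumes z: "z \<in> slit_plane"
  shows "polylog_moebius (s - 1) z = z * (1 - z) * deriv (polylog_moebius s) z"
proof -
  note m = moebius_slit_plane[OF z]
  have "polylog_moebius (s - 1) z = - (z / (z - 1) * deriv (polylog s) (z / (z - 1)))"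
    by (simp add: polylog_moebius_def polylog_diff_1[OF m(2)])
  also have "\<dots> = z * (1 - z) * (deriv (polylog s) (z / (z - 1)) / (z - 1)\<^sup>2)"
    using m(1) by (simp add: power2_eq_square divide_simps) (simp add: algebra_simps)
  finally show ?thesis
    using DERIV_imp_deriv[OF has_field_derivative_polylog_moebius[OF z]] by simp
qed

text \<open>In the Bose-Einstein integrand at w = z / (z - 1) the factor z - 1 cancels. For each
  \<open>t > 0\<close> the resulting kernel is regular even at z = 1.\<close>

lemma polylog_moebius_eq_integral:
  assumes s: "Re s > 1" and z: "z \<in> slit_plane"
  shows "polylog_moebius s z = (\<integral>t. of_real t powr (s - 1) *
     (z * of_real (exp (- t)) / (1 - z * (1 - of_real (exp (- t))))) \<partial>halfline) / Gamma s"
proof -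
  note m = moebius_slit_plane[OF z]
  have "z / (z - 1) * x / (1 - z / (z - 1) * x) = - (z * x / (1 - z * (1 - x)))" for x :: complex
  proof -
    have "1 - z / (z - 1) * x = - (1 - z * (1 - x)) / (z - 1)"
      using m(1) by (simp add: field_simps)
    thus ?thesis using m(1) by (simp add: minus_divide_right)
  qed
  thus ?thesis
    by (simp add: polylog_moebius_def polylog_eq_integral[OF s m(2)] polylog_integral_def)
qed

section \<open>Growth of \<open>polylog_moebius\<close> near the point 1\<close>

lemma slit_plane_moebius_kernel_nonzero:
  "z \<in> slit_plane \<Longrightarrow> t > 0 \<Longrightarrow> 1 - z * (1 - complex_of_real (exp (- t))) \<noteq> 0"
  using slit_plane_denominator_nonzero[of z "1 - exp (- t)"] by simp

lemma cball_subset_slit_plane: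
  assumes "z \<in> {0..<1}" "d \<le> 1 / 2"
  shows "cball (of_real z) (d * (1 - z)) \<subseteq> slit_plane"
proof
  fix w assume "w \<in> cball (complex_of_real z) (d * (1 - z))"
  hence "norm (w - of_real z) \<le> d * (1 - z)" by (simp add: dist_norm norm_minus_commute)
  also have "d * (1 - z) \<le> 1 / 2 * (1 - z)" using assms by (intro mult_right_mono) auto
  also have "\<dots> < 1 - z" using assms by simp
  finally have "norm w < 1" using norm_triangle_ineq2[of w "of_real z"] assms by simp
  thus "w \<in> slit_plane" using ball_subset_slit_plane by auto
qed

text \<open>At the centre of the disk the denominator is D = 1 - z + z x. Moving from
  \<open>z\<close> to \<open>w\<close> changes it by at most (1 - z) / 2, hence by at most D / 2.
  Since D is at least x and at least 1 - z, it is at least their geometric mean. For x = e^(-t) this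
  trades half of the decay in \<open>t\<close> for a singularity in \<open>z\<close> that is still
  integrable.\<close>

lemma norm_moebius_kernel_le:
  fixes z x :: real and w :: complex
  assumes z: "z \<in> {0..<1}" and w: "w \<in> cball (of_real z) ((1 - z) / 2)" and x: "x \<in> {0<..1}"
  shows "norm (w * of_real x / (1 - w * (1 - of_real x))) \<le> 2 * sqrt x / sqrt (1 - z)"
proof -
  define D where "D = 1 - z + z * x"
  have w': "norm (w - of_real z) \<le> (1 - z) / 2"
    using w by (simp add: dist_norm norm_minus_commute)
  have w1: "norm w \<le> 1"
    using norm_triangle_ineq2[of w "of_real z"] w' z by simp
  have "norm ((w - of_real z) * of_real (1 - x)) \<le> (1 - z) / 2 * 1"
    unfolding norm_mult norm_of_real using w' x z by (intro mult_mono) auto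
  moreover have "1 - w * (1 - of_real x) = of_real D - (w - of_real z) * of_real (1 - x)"
    by (simp add: D_def algebra_simps)
  moreover have "D \<ge> 0" using z x by (auto simp: D_def)
  ultimately have "norm (1 - w * (1 - of_real x)) \<ge> D - (1 - z) / 2"
    using norm_triangle_ineq2[of "of_real D" "(w - of_real z) * of_real (1 - x)"]
    by (simp only: norm_of_real)
  moreover have "D - (1 - z) / 2 \<ge> D / 2"
    using mult_nonneg_nonneg[of z x] z x by (simp add: D_def field_simps)
  moreover have "D \<ge> sqrt x * sqrt (1 - z)"
  proof -
    have "0 \<le> (1 - z) * (1 - x)" "0 \<le> z * x" using z x by auto
    hence "D \<ge> x" "D \<ge> 1 - z" by (auto simp: D_def algebra_simps)
    hence "x * (1 - z) \<le> D * D" using x z by (intro mult_mono) auto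
    hence "sqrt (x * (1 - z)) \<le> D"
      using \<open>D \<ge> 0\<close> by (intro real_le_lsqrt) (auto simp: power2_eq_square)
    thus ?thesis by (simp add: real_sqrt_mult)
  qed
  ultimately have "norm (1 - w * (1 - of_real x)) \<ge> sqrt x * sqrt (1 - z) / 2" by linarith
  hence "norm (w * of_real x / (1 - w * (1 - of_real x))) \<le> 1 * x / (sqrt x * sqrt (1 - z) / 2)"
    unfolding norm_divide norm_mult using x z w1 by (intro frac_le mult_mono) auto
  also have "\<dots> = 2 * (x / sqrt x) / sqrt (1 - z)" by simp
  also have "x / sqrt x = sqrt x" using x by (simp add: real_div_sqrt)
  finally show ?thesis .
qed

lemma sqrt_exp_minus: "sqrt (exp (- t)) = exp (- (1 / 2 * t))"
proof -
  have "exp (- t) = (exp (- (1 / 2 * t)))\<^sup>2" by (simp add: power2_eq_square flip: exp_add)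
  thus ?thesis by simp
qed

text \<open>
  Disks shrinking proportionally to the distance from \<open>1\<close> let Cauchy's estimate carry the bound over
  to \<open>z (1 - z) F'\<close> with the same exponent.
\<close>
definition sqrt_growth :: "real \<Rightarrow> (complex \<Rightarrow> complex) \<Rightarrow> bool" where
  "sqrt_growth d f \<longleftrightarrow> (\<exists>C\<ge>0. \<forall>z\<in>{0..<1}. \<forall>w\<in>cball (of_real z) (d * (1 - z)). norm (f w) \<le> C / sqrt (1 - z))"

text \<open>The kernel bound separates \<open>t\<close> from \<open>z\<close>; integrating over
  \<open>t\<close> leaves a convergent Gamma integral as the constant.\<close>

lemma sqrt_growth_polylog_moebius_base:
  assumes s: "Re s > 1"
  shows "sqrt_growth (1 / 2) (polylog_moebius s)"
  unfolding sqrt_growth_def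
proof (intro exI conjI ballI)
  let ?J = "\<integral>t. t powr (Re s - 1) * exp (- (1 / 2 * t)) \<partial>halfline"
  have J: "integrable halfline (\<lambda>t. t powr (Re s - 1) * exp (- (1 / 2 * t)))"
    using has_bochner_integral_Gamma_real[of "Re s" "1/2"] s by (auto simp: has_bochner_integral_iff)
  show "2 * ?J / norm (Gamma s) \<ge> 0" by (auto intro!: divide_nonneg_nonneg integral_nonneg_AE)
  fix z w assume z: "z \<in> {0..<1::real}" and w: "w \<in> cball (complex_of_real z) (1 / 2 * (1 - z))"
  have ws: "w \<in> slit_plane" using cball_subset_slit_plane[OF z, of "1/2"] w by auto
  define f where "f t = of_real t powr (s - 1) *
     (w * of_real (exp (- t)) / (1 - w * (1 - of_real (exp (- t)))))" for t :: real
  have meas: "f \<in> borel_measurable halfline"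
    unfolding f_def using slit_plane_moebius_kernel_nonzero[OF ws]
    by (intro borel_measurable_halfline) (auto intro!: continuous_intros)
  have bound: "norm (f t) \<le> 2 / sqrt (1 - z) * (t powr (Re s - 1) * exp (- (1 / 2 * t)))"
    if "t \<in> space halfline" for t
  proof -
    have t: "t > 0" using that by (auto simp: space_restrict_space)
    have "norm (f t) \<le> t powr (Re s - 1) * (2 * sqrt (exp (- t)) / sqrt (1 - z))"
      unfolding f_def norm_mult[of "of_real t powr (s - 1)"] norm_of_real_powr[OF t]
      using z w t by (intro mult_mono norm_moebius_kernel_le) auto
    thus ?thesis unfolding sqrt_exp_minus by (simp add: mult_ac)
  qed
  have "norm (integral\<^sup>L halfline f) \<le> (\<integral>t. norm (f t) \<partial>halfline)"
    by (rule integral_norm_bound)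
  also have "\<dots> \<le> (\<integral>t. 2 / sqrt (1 - z) * (t powr (Re s - 1) * exp (- (1 / 2 * t))) \<partial>halfline)"
  proof (rule integral_mono)
    show g: "integrable halfline (\<lambda>t. 2 / sqrt (1 - z) * (t powr (Re s - 1) * exp (- (1 / 2 * t))))"
      using J by (rule integrable_mult_right)
    show "integrable halfline (\<lambda>t. norm (f t))"
      by (rule integrable_norm, rule Bochner_Integration.integrable_bound[OF g meas])
        (use z in \<open>auto intro!: AE_I2 order.trans[OF bound]\<close>)
  qed (use bound in auto)
  also have "\<dots> = 2 / sqrt (1 - z) * ?J" by (rule integral_mult_right_zero)
  finally have "norm (integral\<^sup>L halfline f) / norm (Gamma s) \<le> 2 / sqrt (1 - z) * ?J / norm (Gamma s)"
    by (rule divide_right_mono) auto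
  thus "norm (polylog_moebius s w) \<le> 2 * ?J / norm (Gamma s) / sqrt (1 - z)"
    unfolding polylog_moebius_eq_integral[OF s ws] f_def norm_divide by (simp add: mult_ac)
qed

text \<open>Cauchy's estimate on circles of radius proportional to 1 - z costs a factor 1 / (1 - z),
  which the factor 1 - w in w (1 - w) F'(w) restores. Halving \<open>d\<close> makes room for these
  circles.\<close>

lemma sqrt_growth_polylog_moebius_diff_1:
  assumes d: "0 < d" "d \<le> 1 / 2" and growth: "sqrt_growth d (polylog_moebius s)"
  shows "sqrt_growth (d / 2) (polylog_moebius (s - 1))"
proof -
  obtain C where C: "C \<ge> 0"
    "\<And>z w. z \<in> {0..<1} \<Longrightarrow> w \<in> cball (of_real z) (d * (1 - z)) \<Longrightarrow>
       norm (polylog_moebius s w) \<le> C / sqrt (1 - z)"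
    using growth by (auto simp: sqrt_growth_def)
  show ?thesis unfolding sqrt_growth_def
  proof (intro exI conjI ballI)
    \<comment> \<open>The constant is the product of \<open>2 * (1 - z)\<close>, which bounds
      \<open>norm (1 - w)\<close>, and of 1 / r = 2 / (d (1 - z)) from Cauchy's estimate.\<close>
    show "4 * C / d \<ge> 0" using C d by auto
    fix z w assume z: "z \<in> {0..<1::real}" and w: "w \<in> cball (complex_of_real z) (d / 2 * (1 - z))"
    define r where "r = d / 2 * (1 - z)"
    have r: "r > 0" using d z by (auto simp: r_def)
    have sub: "cball w r \<subseteq> cball (of_real z) (d * (1 - z))"
    proof
      fix y assume "y \<in> cball w r"
      thus "y \<in> cball (of_real z) (d * (1 - z))"
        using w dist_triangle[of "of_real z" y w] by (simp add: r_def field_simps)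
    qed
    also have sub': "\<dots> \<subseteq> slit_plane" using z d by (intro cball_subset_slit_plane) auto
    finally have hol: "polylog_moebius s holomorphic_on cball w r"
      using holomorphic_on_polylog_moebius by (rule holomorphic_on_subset[rotated])
    have ws: "w \<in> slit_plane" using sub sub' r by (auto simp: subset_eq)
    have "norm ((deriv ^^ 1) (polylog_moebius s) w) \<le> fact 1 * (C / sqrt (1 - z)) / r ^ 1"
    proof (rule Cauchy_inequality)
      show "polylog_moebius s holomorphic_on ball w r"
        using hol by (rule holomorphic_on_subset) auto
      show "norm (polylog_moebius s x) \<le> C / sqrt (1 - z)" if "norm (w - x) = r" for x
        using that sub by (intro C(2) z) (auto simp: dist_norm subset_eq)
    qed (use hol r in \<open>auto intro: holomorphic_on_imp_continuous_on\<close>)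
    hence D: "norm (deriv (polylog_moebius s) w) \<le> C / sqrt (1 - z) / r" by simp
    have "d / 2 * (1 - z) \<le> 1 * (1 - z)" using d z by (intro mult_right_mono) auto
    hence wz: "norm (w - of_real z) \<le> 1 - z" using w by (simp add: dist_norm norm_minus_commute)
    have "norm w \<le> 1" using norm_triangle_ineq2[of w "of_real z"] wz z by simp
    moreover have "norm (1 - w) \<le> 2 * (1 - z)"
      using norm_triangle_ineq4[of "of_real (1 - z)" "w - of_real z"] wz z norm_minus_commute[of 1 w]
      by (simp del: of_real_diff) (simp add: algebra_simps)
    moreover have cancel: "1 * (2 * y) * (C / q / (d / 2 * y)) = 4 * C / d / q" if "y \<noteq> 0" for y q :: real
      using that by simp
    ultimately have "norm (polylog_moebius (s - 1) w) \<le> 1 * (2 * (1 - z)) * (C / sqrt (1 - z) / r)"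
      unfolding polylog_moebius_diff_1[OF ws] norm_mult using D z by (intro mult_mono) auto
    also have "\<dots> = 4 * C / d / sqrt (1 - z)" using cancel[of "1 - z" "sqrt (1 - z)"] z by (simp only: r_def) simp
    finally show "norm (polylog_moebius (s - 1) w) \<le> 4 * C / d / sqrt (1 - z)" .
  qed
qed

text \<open>The disks shrink with every step to the left, which does no harm: in the end only their
  centres matter.\<close>

lemma polylog_moebius_bound:
  "\<exists>C\<ge>0. \<forall>z\<in>{0..<1}. norm (polylog_moebius s (of_real z)) \<le> C / sqrt (1 - z)"
proof -
  have ex: "\<exists>d>0. d \<le> 1 / 2 \<and> sqrt_growth d (polylog_moebius s)" if "Re s > 1 - real N" for N s
    using that
  proof (induction N arbitrary: s)
    case 0
    thus ?case using sqrt_growth_polylog_moebius_base[of s] by (intro exI[of _ "1/2"]) auto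
  next
    case (Suc N)
    from Suc.IH[of "s + 1"] Suc.prems obtain d
      where "0 < d" "d \<le> 1 / 2" "sqrt_growth d (polylog_moebius (s + 1))" by auto
    with sqrt_growth_polylog_moebius_diff_1[of d "s + 1"] show ?case
      by (intro exI[of _ "d/2"]) auto
  qed
  obtain N :: nat where "real N > 1 - Re s" using reals_Archimedean2 by blast
  with ex[of N s] obtain d where d: "d > 0" "sqrt_growth d (polylog_moebius s)" by auto
  then obtain C where C: "C \<ge> 0" "\<And>z w. z \<in> {0..<1} \<Longrightarrow> w \<in> cball (of_real z) (d * (1 - z)) \<Longrightarrow>
       norm (polylog_moebius s w) \<le> C / sqrt (1 - z)"
    unfolding sqrt_growth_def by blast
  show ?thesis
  proof (intro exI conjI ballI)
    show "norm (polylog_moebius s (of_real z)) \<le> C / sqrt (1 - z)" if "z \<in> {0..<1}" for z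
      using that d by (intro C(2)) auto
  qed (use C in auto)
qed

subsection \<open>Polynomial moments over the unit interval\<close>

text \<open>Half open, so that its points lie in \<open>slit_plane\<close>; the omitted endpoint is
  a null set.\<close>

abbreviation unit_interval :: "real measure" where
  "unit_interval \<equiv> restrict_space lborel {0..<1}"

lemma borel_measurable_unit_interval:
  "continuous_on {0..<1} f \<Longrightarrow> f \<in> borel_measurable unit_interval"
  for f :: "real \<Rightarrow> 'b::topological_space"
  using borel_measurable_continuous_on_restrict[of "{0..<1}" f]
  by (simp cong: measurable_cong_sets add: sets_restrict_space)

lemma has_integral_unit_interval:
  fixes f :: "real \<Rightarrow> 'a::euclidean_space"
  assumes "integrable unit_interval f"
  shows "(f has_integral integral\<^sup>L unit_interval f) {0..1}"
proof -
  have int: "set_integrable lborel {0..<1} f"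
    using assms by (simp add: integrable_restrict_space set_integrable_def)
  have "integral\<^sup>L unit_interval f = (LINT x:{0..<1}|lborel. f x)"
    by (simp add: integral_restrict_space set_lebesgue_integral_def)
  with set_borel_integral_eq_integral[OF int] have "(f has_integral integral\<^sup>L unit_interval f) {0..<1}"
    by (simp add: has_integral_integral)
  moreover have "negligible {x \<in> {0..<1} - {0..1}. f x \<noteq> 0}" "negligible {x \<in> {0..1} - {0..<1}. f x \<noteq> 0}"
    by (rule negligible_subset[of "{1}"]; force)+
  ultimately show ?thesis using has_integral_spike_set_eq[of "{0..<1}" "{0..1}" f] by blast
qed

text \<open>This is the Beta integral with parameters 1 and 1/2.\<close>

lemma integrable_inverse_sqrt: "integrable unit_interval (\<lambda>z. 1 / sqrt (1 - z))"
proof -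
  have "set_integrable lborel {0..1} (\<lambda>t::real. t powr (1 - 1) * (1 - t) powr (1 / 2 - 1))"
    by (rule integrable_Beta) auto
  hence "set_integrable lborel {0..<1} (\<lambda>t::real. t powr (1 - 1) * (1 - t) powr (1 / 2 - 1))"
    by (rule set_integrable_subset) auto
  hence "integrable unit_interval (\<lambda>t::real. t powr (1 - 1) * (1 - t) powr (1 / 2 - 1))"
    by (simp add: integrable_restrict_space set_integrable_def)
  moreover have "(\<lambda>z::real. 1 / sqrt (1 - z)) \<in> borel_measurable unit_interval"
    by (intro borel_measurable_unit_interval continuous_intros) auto
  ultimately show ?thesis
  proof (rule Bochner_Integration.integrable_bound)
    \<comment> \<open>The comparison fails at \<open>t = 0\<close>, where
      \<open>t powr (1 - 1)\<close> is 0 by convention, so it is only claimed almost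
      everywhere.\<close>
    have "AE t in lborel. t \<noteq> (0::real)" by (rule AE_lborel_singleton)
    hence "AE t in unit_interval. t \<noteq> (0::real)"
      by (subst AE_restrict_space_iff) auto
    thus "AE t in unit_interval. norm (1 / sqrt (1 - t)) \<le> norm (t powr (1 - 1) * (1 - t) powr (1 / 2 - 1))"
      using AE_space[of unit_interval]
    proof eventually_elim
      case (elim t)
      hence "t > 0" "t < 1" by (auto simp: space_restrict_space)
      moreover have "(1 - t) powr (- (1 / 2)) = 1 / (1 - t) powr (1 / 2)" by (rule powr_minus_divide)
      ultimately show ?case by (simp add: powr_half_sqrt)
    qed
  qed
qed

section \<open>The kernel \<open>K(t, z)\<close> of the overview and its moments in
  \<open>z\<close>\<close>

definition moebius_kernel :: "real \<Rightarrow> complex \<Rightarrow> complex" where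
  "moebius_kernel t z = z * of_real (exp (- t)) / (1 - z * (1 - of_real (exp (- t))))"

definition kernel_moment :: "complex poly \<Rightarrow> real \<Rightarrow> complex" where
  "kernel_moment p t = (\<integral>z. poly p (of_real z) * moebius_kernel t (of_real z) \<partial>unit_interval)"

lemma poly_bound_unit_interval:
  fixes p :: "complex poly"
  obtains B where "B \<ge> 0" "\<And>z. z \<in> {0..1} \<Longrightarrow> norm (poly p (of_real z)) \<le> B"
proof -
  have "continuous_on {0..1} (\<lambda>z::real. poly p (of_real z))" by (intro continuous_intros)
  hence "compact ((\<lambda>z::real. poly p (of_real z)) ` {0..1})"
    by (intro compact_continuous_image) auto
  then obtain B where "B > 0" "\<And>y. y \<in> (\<lambda>z::real. poly p (of_real z)) ` {0..1} \<Longrightarrow> norm y \<le> B"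
    using compact_imp_bounded bounded_pos by metis
  thus ?thesis using that[of B] by auto
qed

lemma norm_moebius_kernel_le':
  assumes "z \<in> {0..<1}" "t > 0"
  shows "norm (moebius_kernel t (of_real z)) \<le> 2 * exp (- (1 / 2 * t)) * (1 / sqrt (1 - z))"
  using norm_moebius_kernel_le[of z "of_real z" "exp (- t)"] assms
  unfolding moebius_kernel_def sqrt_exp_minus by simp

lemma of_real_in_slit_plane: "z < 1 \<Longrightarrow> of_real z \<in> slit_plane"
  by (auto simp: slit_plane_def)

lemma measurable_kernel_pair:
  "(\<lambda>q. poly p (of_real (fst q)) * moebius_kernel (snd q) (of_real (fst q)))
     \<in> borel_measurable (unit_interval \<Otimes>\<^sub>M halfline)"
proof -
  have [measurable]: "(\<lambda>z. z) \<in> borel_measurable unit_interval" "(\<lambda>z. z) \<in> borel_measurable halfline"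
    by (auto intro: measurable_restrict_space1)
  have [measurable]: "(\<lambda>z. poly p (complex_of_real z)) \<in> borel_measurable borel"
    by (intro borel_measurable_continuous_onI continuous_intros)
  have [measurable]: "fst \<in> borel_measurable (unit_interval \<Otimes>\<^sub>M halfline)"
     "snd \<in> borel_measurable (unit_interval \<Otimes>\<^sub>M halfline)"
    using measurable_compose[OF measurable_fst, of "\<lambda>z. z" unit_interval borel halfline]
      measurable_compose[OF measurable_snd, of "\<lambda>z. z" halfline borel unit_interval] by auto
  show ?thesis unfolding moebius_kernel_def
    by measurable
qed

text \<open>Fubini: the kernel bound dominates the integrand by a function integrable in
  \<open>z\<close> times a function integrable in \<open>t\<close>. Integrating over
  \<open>z\<close> first leaves the Mellin transform of \<open>kernel_moment p\<close>.\<close>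

lemma polylog_moebius_moment:
  assumes s: "Re s > 1"
  shows "((\<lambda>z. poly p (of_real z) * polylog_moebius s (of_real z)) has_integral
           (\<integral>t. of_real t powr (s - 1) * kernel_moment p t \<partial>halfline) / Gamma s) {0..1}"
proof -
  interpret N: sigma_finite_measure unit_interval
    by (intro sigma_finite_measure_restrict_space sigma_finite_lborel) auto
  interpret H: sigma_finite_measure halfline
    by (intro sigma_finite_measure_restrict_space sigma_finite_lborel) auto
  interpret pair_sigma_finite unit_interval halfline ..
  have G: "Gamma s \<noteq> 0" using s by (auto simp: Gamma_eq_zero_iff elim!: nonpos_Ints_cases)
  obtain B where B: "B \<ge> 0" "\<And>z. z \<in> {0..1} \<Longrightarrow> norm (poly p (of_real z)) \<le> B"
    using poly_bound_unit_interval by blast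
  define f where "f z t = of_real t powr (s - 1) * (poly p (of_real z) * moebius_kernel t (of_real z))" for z t :: real
  let ?g = "\<lambda>t. t powr (Re s - 1) * exp (- (1 / 2 * t))"
  define J where "J = integral\<^sup>L halfline ?g"
  have J: "integrable halfline ?g"
    using has_bochner_integral_Gamma_real[of "Re s" "1/2"] s by (auto simp: has_bochner_integral_iff)
  have bound: "norm (f z t) \<le> 2 * B / sqrt (1 - z) * ?g t"
    if "z \<in> space unit_interval" "t \<in> space halfline" for z t
  proof -
    have zt: "z \<in> {0..<1}" "t > 0" using that by (auto simp: space_restrict_space)
    have "norm (f z t) \<le> t powr (Re s - 1) * (B * (2 * exp (- (1 / 2 * t)) * (1 / sqrt (1 - z))))"
      unfolding f_def norm_mult[of "of_real t powr (s - 1)"] norm_mult[of "poly p (of_real z)"] norm_of_real_powr[OF zt(2)]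
      using B zt by (intro mult_mono norm_moebius_kernel_le' mult_nonneg_nonneg) auto
    thus ?thesis by (simp add: mult_ac)
  qed
  have powr_meas: "(\<lambda>t::real. of_real t powr (s - 1)) \<in> borel_measurable halfline"
    by (intro borel_measurable_halfline) (auto intro!: continuous_intros)
  have meas: "case_prod f \<in> borel_measurable (unit_interval \<Otimes>\<^sub>M halfline)"
    unfolding f_def case_prod_beta
    by (intro borel_measurable_times measurable_kernel_pair[of p]
          measurable_compose[OF measurable_snd powr_meas])
  have meas_z: "f z \<in> borel_measurable halfline" if "z \<in> space unit_interval" for z
    using measurable_compose[OF measurable_Pair1'[OF that] meas] by simp
  have int_z: "integrable halfline (f z)" if "z \<in> space unit_interval" for z
  proof (rule Bochner_Integration.integrable_bound)
    show "integrable halfline (\<lambda>t. 2 * B / sqrt (1 - z) * ?g t)" using J by (rule integrable_mult_right)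
    show "AE t in halfline. norm (f z t) \<le> norm (2 * B / sqrt (1 - z) * ?g t)"
      unfolding real_norm_def by (intro AE_I2 order.trans[OF bound[OF that] abs_ge_self])
  qed (use meas_z that in auto)
  have int: "integrable (unit_interval \<Otimes>\<^sub>M halfline) (case_prod f)"
  proof (rule Fubini_integrable[OF meas])
    show "AE z in unit_interval. integrable halfline (\<lambda>t. case_prod f (z, t))"
      using int_z by (intro AE_I2) auto
    show "integrable unit_interval (\<lambda>z. \<integral>t. norm (case_prod f (z, t)) \<partial>halfline)"
    proof (rule Bochner_Integration.integrable_bound)
      show "integrable unit_interval (\<lambda>z. 2 * B * J * (1 / sqrt (1 - z)))"
        using integrable_inverse_sqrt by (rule integrable_mult_right)
      show "(\<lambda>z. \<integral>t. norm (case_prod f (z, t)) \<partial>halfline) \<in> borel_measurable unit_interval"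
        using meas by measurable
      show "AE z in unit_interval. norm (\<integral>t. norm (case_prod f (z, t)) \<partial>halfline)
              \<le> norm (2 * B * J * (1 / sqrt (1 - z)))"
      proof (rule AE_I2)
        fix z assume z: "z \<in> space unit_interval"
        have "(\<integral>t. norm (f z t) \<partial>halfline) \<le> (\<integral>t. 2 * B / sqrt (1 - z) * ?g t \<partial>halfline)"
          using bound[OF z] int_z[OF z] J by (intro integral_mono integrable_norm integrable_mult_right) auto
        also have "\<dots> = 2 * B / sqrt (1 - z) * J" unfolding J_def by (rule integral_mult_right_zero)
        finally have "(\<integral>t. norm (f z t) \<partial>halfline) \<le> 2 * B * J * (1 / sqrt (1 - z))"
          by (simp add: mult_ac)
        hence "(\<integral>t. norm (f z t) \<partial>halfline) \<le> norm (2 * B * J * (1 / sqrt (1 - z)))"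
          unfolding real_norm_def by (rule order.trans[OF _ abs_ge_self])
        moreover have "(\<integral>t. norm (f z t) \<partial>halfline) \<ge> 0" by (intro integral_nonneg_AE) auto
        ultimately show "norm (\<integral>t. norm (case_prod f (z, t)) \<partial>halfline)
              \<le> norm (2 * B * J * (1 / sqrt (1 - z)))" by simp
      qed
    qed
  qed
  have inner: "(\<integral>t. f z t \<partial>halfline) = Gamma s * (poly p (of_real z) * polylog_moebius s (of_real z))"
    if "z \<in> space unit_interval" for z
  proof -
    have "z < 1" using that by (auto simp: space_restrict_space)
    have "(\<integral>t. f z t \<partial>halfline) = (\<integral>t. poly p (of_real z) * (of_real t powr (s - 1) * moebius_kernel t (of_real z)) \<partial>halfline)"
      by (intro Bochner_Integration.integral_cong) (auto simp: f_def mult_ac)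
    also have "\<dots> = poly p (of_real z) * (\<integral>t. of_real t powr (s - 1) * moebius_kernel t (of_real z) \<partial>halfline)"
      by (rule integral_mult_right_zero)
    finally show ?thesis
      using polylog_moebius_eq_integral[OF s of_real_in_slit_plane[OF \<open>z < 1\<close>]] G
      by (simp add: moebius_kernel_def)
  qed
  have "integrable unit_interval (\<lambda>z. \<integral>t. f z t \<partial>halfline)" by (rule integrable_fst[OF int])
  hence "integrable unit_interval (\<lambda>z. Gamma s * (poly p (of_real z) * polylog_moebius s (of_real z)))"
    by (subst (asm) Bochner_Integration.integrable_cong[OF refl inner]) auto
  hence "((\<lambda>z. Gamma s * (poly p (of_real z) * polylog_moebius s (of_real z))) has_integral
    (\<integral>z. Gamma s * (poly p (of_real z) * polylog_moebius s (of_real z)) \<partial>unit_interval)) {0..1}"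
    by (rule has_integral_unit_interval)
  also have "(\<integral>z. Gamma s * (poly p (of_real z) * polylog_moebius s (of_real z)) \<partial>unit_interval) =
     (\<integral>z. (\<integral>t. f z t \<partial>halfline) \<partial>unit_interval)"
    using inner by (intro Bochner_Integration.integral_cong) auto
  also have "\<dots> = (\<integral>t. (\<integral>z. f z t \<partial>unit_interval) \<partial>halfline)"
    by (rule Fubini_integral[OF int, symmetric])
  also have "\<dots> = (\<integral>t. of_real t powr (s - 1) * kernel_moment p t \<partial>halfline)"
    unfolding f_def kernel_moment_def by simp
  finally have "((\<lambda>z. Gamma s * (poly p (of_real z) * polylog_moebius s (of_real z))) has_integral
    (\<integral>t. of_real t powr (s - 1) * kernel_moment p t \<partial>halfline)) {0..1}" .
  from has_integral_divide[OF this, of "Gamma s"] show ?thesis using G by simp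
qed

lemma measurable_kernel_moment: "kernel_moment p \<in> borel_measurable halfline"
proof -
  interpret N: sigma_finite_measure unit_interval
    by (intro sigma_finite_measure_restrict_space sigma_finite_lborel) auto
  have "(\<lambda>(t, z). poly p (of_real z) * moebius_kernel t (of_real z)) \<in> borel_measurable (halfline \<Otimes>\<^sub>M unit_interval)"
    using measurable_compose[OF measurable_pair_swap' measurable_kernel_pair[of p]] by (simp add: case_prod_beta)
  from N.borel_measurable_lebesgue_integral[OF this] show ?thesis
    unfolding kernel_moment_def[abs_def] by simp
qed

text \<open>The factor e^(-t/2) of the kernel bound survives integration over \<open>z\<close>; this
  decay makes the Mellin integral converge at infinity.\<close>

lemma kernel_moment_bound:
  obtains C where "C \<ge> 0" "\<And>t. t > 0 \<Longrightarrow> norm (kernel_moment p t) \<le> C * exp (- (1 / 2 * t))"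
proof -
  obtain B where B: "B \<ge> 0" "\<And>z. z \<in> {0..1} \<Longrightarrow> norm (poly p (of_real z)) \<le> B"
    using poly_bound_unit_interval by blast
  define I where "I = (\<integral>z. 1 / sqrt (1 - z) \<partial>unit_interval)"
  have "I \<ge> 0" unfolding I_def by (intro integral_nonneg_AE AE_I2) (auto simp: space_restrict_space)
  have "norm (kernel_moment p t) \<le> 2 * B * I * exp (- (1 / 2 * t))" if t: "t > 0" for t
  proof -
    let ?f = "\<lambda>z. poly p (of_real z) * moebius_kernel t (of_real z)"
    have b: "norm (?f z) \<le> 2 * B * exp (- (1 / 2 * t)) * (1 / sqrt (1 - z))" if "z \<in> space unit_interval" for z
    proof -
      have z: "z \<in> {0..<1}" using that by (auto simp: space_restrict_space)
      have "norm (?f z) \<le> B * (2 * exp (- (1 / 2 * t)) * (1 / sqrt (1 - z)))"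
        unfolding norm_mult[of "poly p (of_real z)"] using z t B by (intro mult_mono norm_moebius_kernel_le') auto
      thus ?thesis by (simp add: mult_ac)
    qed
    have int: "integrable unit_interval (\<lambda>z. 2 * B * exp (- (1 / 2 * t)) * (1 / sqrt (1 - z)))"
      using integrable_inverse_sqrt by (rule integrable_mult_right)
    have meas: "?f \<in> borel_measurable unit_interval"
      unfolding moebius_kernel_def using slit_plane_moebius_kernel_nonzero[OF of_real_in_slit_plane t]
      by (intro borel_measurable_unit_interval) (auto intro!: continuous_intros)
    have "norm (kernel_moment p t) \<le> (\<integral>z. norm (?f z) \<partial>unit_interval)"
      unfolding kernel_moment_def by (rule integral_norm_bound)
    also have "\<dots> \<le> (\<integral>z. 2 * B * exp (- (1 / 2 * t)) * (1 / sqrt (1 - z)) \<partial>unit_interval)"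
    proof (rule integral_mono)
      show "integrable unit_interval (\<lambda>z. norm (?f z))"
        by (rule integrable_norm, rule Bochner_Integration.integrable_bound[OF int meas])
          (unfold real_norm_def, intro AE_I2 order.trans[OF b abs_ge_self])
    qed (use b int in auto)
    also have "\<dots> = 2 * B * exp (- (1 / 2 * t)) * I"
      unfolding I_def by (rule integral_mult_right_zero)
    finally show ?thesis by (simp add: mult_ac)
  qed
  thus ?thesis using that[of "2 * B * I"] B \<open>I \<ge> 0\<close> by auto
qed

lemma powr_le_powr_add_powr:
  fixes t b :: real
  assumes "t > 0" "a \<le> b" "b \<le> c"
  shows "t powr b \<le> t powr a + t powr c"
proof (cases "t \<le> 1")
  case True
  hence "t powr b \<le> t powr a" using assms by (intro powr_mono') auto
  thus ?thesis using powr_ge_zero[of t c] by linarith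
next
  case False
  hence "t powr b \<le> t powr c" using assms by (intro powr_mono) auto
  thus ?thesis using powr_ge_zero[of t a] by linarith
qed

lemma holomorphic_mellin_kernel_moment:
  "(\<lambda>s. \<integral>t. of_real t powr (s - 1) * kernel_moment p t \<partial>halfline) holomorphic_on {s. Re s > 1}"
proof (rule holomorphic_on_lebesgue_integral)
  show "open {s. Re s > 1}" by (simp add: open_halfspace_Re_gt)
  show "(\<lambda>s. of_real t powr (s - 1) * kernel_moment p t) holomorphic_on {s. Re s > 1}"
    if "t \<in> space halfline" for t
    using that by (auto intro!: holomorphic_intros simp: space_restrict_space)
  have "(\<lambda>t::real. of_real t powr (s - 1)) \<in> borel_measurable halfline" for s :: complex
    by (intro borel_measurable_halfline) (auto intro!: continuous_intros)
  thus "(\<lambda>t. of_real t powr (s - 1) * kernel_moment p t) \<in> borel_measurable halfline" for s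
    by (intro borel_measurable_times measurable_kernel_moment)
  fix a assume "a \<in> {s. Re s > 1}"
  hence a: "Re a > 1" by simp
  obtain C where C: "C \<ge> 0" "\<And>t. t > 0 \<Longrightarrow> norm (kernel_moment p t) \<le> C * exp (- (1 / 2 * t))"
    using kernel_moment_bound by blast
  \<comment> \<open>For \<open>s\<close> within distance 1 of \<open>a\<close>, the exponent
    \<open>Re s - 1\<close> lies between the two exponents used here. The smaller one dominates for
    \<open>t\<close> below 1 and the larger one above 1; both yield Gamma integrals, the first
    because \<open>Re a - 1 > 0\<close>.\<close>
  define g where "g t = C * (t powr (Re a - 1 - 1) * exp (- (1 / 2 * t)) + t powr (Re a + 1 - 1) * exp (- (1 / 2 * t)))" for t
  show "\<exists>r>0. \<exists>g. integrable halfline g \<and>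
     (\<forall>s\<in>ball a r \<inter> {s. Re s > 1}. \<forall>t\<in>space halfline. norm (of_real t powr (s - 1) * kernel_moment p t) \<le> g t)"
  proof (rule exI[of _ 1], intro conjI exI[of _ g] ballI)
    show "integrable halfline g"
      unfolding g_def using has_bochner_integral_Gamma_real[of "Re a - 1" "1/2"]
        has_bochner_integral_Gamma_real[of "Re a + 1" "1/2"] a
      by (intro integrable_mult_right Bochner_Integration.integrable_add) (auto simp: has_bochner_integral_iff)
    fix s t assume s: "s \<in> ball a 1 \<inter> {s. Re s > 1}" and "t \<in> space halfline"
    hence t: "t > 0" by (auto simp: space_restrict_space)
    have "\<bar>Re (s - a)\<bar> \<le> 1" using s abs_Re_le_cmod[of "s - a"]
      by (simp add: dist_norm norm_minus_commute)
    hence "t powr (Re s - 1) \<le> t powr (Re a - 1 - 1) + t powr (Re a + 1 - 1)"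
      using t by (intro powr_le_powr_add_powr) auto
    hence "t powr (Re s - 1) * norm (kernel_moment p t) \<le>
       (t powr (Re a - 1 - 1) + t powr (Re a + 1 - 1)) * (C * exp (- (1 / 2 * t)))"
      using C t by (intro mult_mono) auto
    thus "norm (of_real t powr (s - 1) * kernel_moment p t) \<le> g t"
      using t by (simp add: norm_mult norm_of_real_powr g_def algebra_simps)
  qed auto
qed

section \<open>Polynomial moments as entire functions of the order\<close>

definition polylog_moment :: "complex poly \<Rightarrow> complex \<Rightarrow> complex" where
  "polylog_moment p s = integral {0..1} (\<lambda>z. poly p (of_real z) * polylog_moebius s (of_real z))"

text \<open>
  The Henstock--Kurzweil integral yields integrability here without any absolute bound on the left-hand
  integrand. At \<open>z = 1\<close> the value of \<open>polylog_moebius\<close> is junk (\<open>- polylog s (1 / 0)\<close>), but it is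
  multiplied by \<open>0\<close>.
\<close>
lemma polylog_moment_diff_1:
  defines "q \<equiv> \<lambda>p::complex poly. pderiv (p * [:0, 1, -1:])"
  assumes J: "((\<lambda>z. poly (q p) (of_real z) * polylog_moebius s (of_real z)) has_integral J) {0..1}"
  shows "((\<lambda>z. poly p (of_real z) * polylog_moebius (s - 1) (of_real z)) has_integral - J) {0..1}"
proof -
  define r where "r = p * [:0, 1, -1:]"
  define G where "G z = poly r z * polylog_moebius s z" for z
  have qr: "q p = pderiv r" unfolding q_def r_def ..
  have r: "poly r z = poly p z * (z * (1 - z))" for z by (simp add: r_def algebra_simps)
  have deriv: "(G has_field_derivative (poly (q p) z * polylog_moebius s z + poly p z * polylog_moebius (s - 1) z)) (at z)"
    if "z \<in> slit_plane" for z
  proof -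
    have "(polylog_moebius s has_field_derivative deriv (polylog_moebius s) z) (at z)"
      using that by (intro holomorphic_derivI[OF holomorphic_on_polylog_moebius open_slit_plane])
    from DERIV_mult[OF poly_DERIV[of r z] this] show ?thesis
      unfolding G_def qr by (simp add: polylog_moebius_diff_1[OF that] r mult_ac)
  qed
  have cont: "continuous_on {0..1} (\<lambda>z::real. G (of_real z))"
    unfolding continuous_on_eq_continuous_within
  proof
    fix x :: real assume x: "x \<in> {0..1}"
    show "continuous (at x within {0..1}) (\<lambda>z. G (of_real z))"
    proof (cases "x < 1")
      case True
      hence "isCont G (of_real x)"
        using DERIV_isCont[OF deriv[OF of_real_in_slit_plane]] by blast
      moreover have "isCont complex_of_real x" by (intro continuous_intros)
      ultimately have "isCont (\<lambda>z. G (of_real z)) x" by (rule isCont_o2[rotated])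
      thus ?thesis by (rule continuous_at_imp_continuous_at_within)
    next
      case False
      hence [simp]: "x = 1" using x by auto
      obtain B where B: "B \<ge> 0" "\<And>z. z \<in> {0..1} \<Longrightarrow> norm (poly p (of_real z)) \<le> B"
        using poly_bound_unit_interval by blast
      obtain C where C: "C \<ge> 0" "\<And>z. z \<in> {0..<1} \<Longrightarrow> norm (polylog_moebius s (of_real z)) \<le> C / sqrt (1 - z)"
        using polylog_moebius_bound[of s] by blast
      \<comment> \<open>The factor 1 - z of \<open>r\<close> outweighs the growth of order (1 -
        z)^(-1/2), so \<open>G\<close> tends to its value 0 at the endpoint.\<close>
      have bound: "norm (G (of_real z)) \<le> B * C * sqrt (1 - z)" if "z \<in> {0..1}" for z
      proof (cases "z = 1")
        case False
        hence z: "z \<in> {0..<1}" using that by auto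
        have n: "norm (1 - complex_of_real z) = 1 - z"
          using z norm_of_real[of "1 - z", where 'a = complex] by simp
        have "norm (G (of_real z)) \<le> (B * (1 * (1 - z))) * (C / sqrt (1 - z))"
          unfolding G_def r norm_mult n using z B C by (intro mult_mono mult_nonneg_nonneg) auto
        also have "\<dots> = B * C * ((1 - z) / sqrt (1 - z))" by simp
        also have "(1 - z) / sqrt (1 - z) = sqrt (1 - z)" using z by (simp add: real_div_sqrt)
        finally show ?thesis .
      qed (simp add: G_def r)
      have "((\<lambda>z. G (of_real z)) \<longlongrightarrow> 0) (at x within {0..1})"
      proof (rule Lim_null_comparison)
        show "\<forall>\<^sub>F z in at x within {0..1}. norm (G (of_real z)) \<le> B * C * sqrt (1 - z)"
          using bound by (auto simp: eventually_at_filter)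
        have "((\<lambda>z. B * C * sqrt (1 - z)) \<longlongrightarrow> B * C * sqrt (1 - x)) (at x within {0..1})"
          by (intro tendsto_intros)
        thus "((\<lambda>z. B * C * sqrt (1 - z)) \<longlongrightarrow> 0) (at x within {0..1})" by simp
      qed
      thus ?thesis by (simp add: continuous_within G_def r)
    qed
  qed
  \<comment> \<open>Continuity up to the endpoints and differentiability in the interior suffice
    here. Both boundary values vanish, because \<open>r\<close> has the factors z and 1 - z.\<close>
  have "((\<lambda>z. poly (q p) (of_real z) * polylog_moebius s (of_real z) + poly p (of_real z) * polylog_moebius (s - 1) (of_real z))
     has_integral (G (of_real 1) - G (of_real 0))) {0..1}"
    using cont by (intro fundamental_theorem_of_calculus_interior has_vector_derivative_real_field deriv of_real_in_slit_plane) auto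
  from has_integral_diff[OF this J] show ?thesis by (simp add: G_def r)
qed

text \<open>The induction over half planes treats all polynomials at once: the moment of
  \<open>p\<close> at \<open>s\<close> is minus the moment at \<open>s + 1\<close> of the different
  polynomial (p z (1 - z))'. This identity carries both integrability and holomorphy one unit to the
  left.\<close>

lemma
  shows integrable_polylog_moment:
      "(\<lambda>z. poly p (of_real z) * polylog_moebius s (of_real z)) integrable_on {0..1}"
    and holomorphic_on_polylog_moment: "polylog_moment p holomorphic_on UNIV"
proof -
  have main: "(\<forall>s. Re s > 1 - real N \<longrightarrow>
      (\<lambda>z. poly p (of_real z) * polylog_moebius s (of_real z)) integrable_on {0..1}) \<and>
     polylog_moment p holomorphic_on {s. Re s > 1 - real N}" for N p
  proof (induction N arbitrary: p)
    case 0
    have "polylog_moment p s = (\<integral>t. of_real t powr (s - 1) * kernel_moment p t \<partial>halfline) / Gamma s"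
      if "Re s > 1" for s
      unfolding polylog_moment_def using polylog_moebius_moment[OF that] by (rule integral_unique)
    moreover have "(\<lambda>s. (\<integral>t. of_real t powr (s - 1) * kernel_moment p t \<partial>halfline) / Gamma s) holomorphic_on {s. Re s > 1}"
      by (intro holomorphic_intros holomorphic_mellin_kernel_moment)
        (auto simp: Gamma_eq_zero_iff elim!: nonpos_Ints_cases)
    ultimately have "polylog_moment p holomorphic_on {s. Re s > 1}"
      by (subst holomorphic_cong[OF refl]) auto
    thus ?case using polylog_moebius_moment by (auto simp: has_integral_integrable)
  next
    case (Suc N)
    define q where "q = pderiv (p * [:0, 1, -1:])"
    have J: "((\<lambda>z. poly p (of_real z) * polylog_moebius s (of_real z)) has_integral - polylog_moment q (s + 1)) {0..1}"
      if "Re s > 1 - real (Suc N)" for s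
    proof -
      have "((\<lambda>z. poly q (of_real z) * polylog_moebius (s + 1) (of_real z)) has_integral polylog_moment q (s + 1)) {0..1}"
        unfolding polylog_moment_def using Suc.IH[of q] that by (intro integrable_integral) auto
      from polylog_moment_diff_1[OF this[unfolded q_def]] show ?thesis by (simp add: q_def)
    qed
    have "(polylog_moment q \<circ> (\<lambda>s. s + 1)) holomorphic_on {s. Re s > 1 - real (Suc N)}"
      using Suc.IH[of q] by (intro holomorphic_on_compose_gen[of _ _ _ "{s. Re s > 1 - real N}"]) (auto intro!: holomorphic_intros)
    hence "(\<lambda>s. - polylog_moment q (s + 1)) holomorphic_on {s. Re s > 1 - real (Suc N)}"
      by (auto intro!: holomorphic_on_minus simp: o_def)
    moreover have "polylog_moment p s = - polylog_moment q (s + 1)" if "Re s > 1 - real (Suc N)" for s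
      using integral_unique[OF J[OF that]] by (simp add: polylog_moment_def)
    ultimately have "polylog_moment p holomorphic_on {s. Re s > 1 - real (Suc N)}"
      by (subst holomorphic_cong[OF refl]) auto
    thus ?case using J by (auto simp: has_integral_integrable)
  qed
  have ex: "\<exists>N::nat. Re s > 1 - real N" for s
    using reals_Archimedean2[of "1 - Re s"] by (auto simp: algebra_simps)
  show "(\<lambda>z. poly p (of_real z) * polylog_moebius s (of_real z)) integrable_on {0..1}"
    using main ex by blast
  have "polylog_moment p holomorphic_on (\<Union>N. {s. Re s > 1 - real N})"
    using main by (intro holomorphic_on_UN_open) (auto simp: open_halfspace_Re_gt)
  also have "(\<Union>N. {s. Re s > 1 - real N}) = UNIV" using ex by auto
  finally show "polylog_moment p holomorphic_on UNIV" .
qed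

subsection \<open>The zeta function and the series \<open>Z\<close>\<close>

text \<open>With x = e^(-t), an explicit antiderivative in \<open>z\<close> evaluates the moment to
  t x / (1 - x)^2 - x / (1 - x). Both fractions are then expanded in powers of x.\<close>

lemma kernel_moment_1_sums:
  assumes t: "t > 0"
  shows "(\<lambda>n. of_real ((real (Suc n) * t - 1) * exp (- (real (Suc n) * t)))) sums kernel_moment 1 t"
proof -
  define x where "x = exp (- t)"
  have x: "0 < x" "x < 1" using t by (auto simp: x_def)
  define b where "b = 1 / (1 - x)"
  \<comment> \<open>Found by writing z / (1 - z y) as (1 / (1 - z y) - 1) / y with y = 1 - x. At z =
    1 the logarithm equals ln x = -t, which is the origin of the factor \<open>t\<close> in the
    sum.\<close>
  define A where "A z = x * (- (z * b) - ln (1 - z * (1 - x)) * b\<^sup>2)" for z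
  have pos: "1 - z * (1 - x) > 0" if "z \<in> {0..1}" for z
  proof -
    have "z * (1 - x) \<le> 1 * (1 - x)" using that x by (intro mult_right_mono) auto
    also have "\<dots> < 1" using x by simp
    finally show ?thesis by simp
  qed
  have "((\<lambda>z. z * x / (1 - z * (1 - x))) has_integral (A 1 - A 0)) {0..1}"
  proof (rule fundamental_theorem_of_calculus)
    fix z :: real assume z: "z \<in> {0..1}"
    have alg: "x * (- (1 / y) - (- y) / (1 - z * y) * (1 / y)\<^sup>2) = z * x / (1 - z * y)"
      if "y \<noteq> 0" "1 - z * y \<noteq> 0" for y :: real
      using that by (simp add: divide_simps power2_eq_square)
    have "(A has_real_derivative x * (- b - (x - 1) / (1 - z * (1 - x)) * b\<^sup>2)) (at z)"
      unfolding A_def using pos[OF z] by (auto intro!: derivative_eq_intros)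
    also have "x * (- b - (x - 1) / (1 - z * (1 - x)) * b\<^sup>2) = z * x / (1 - z * (1 - x))"
      unfolding b_def using alg[of "1 - x"] pos[OF z] x by simp
    finally show "(A has_vector_derivative z * x / (1 - z * (1 - x))) (at z within {0..1})"
      by (auto simp: has_real_derivative_iff_has_vector_derivative intro: has_vector_derivative_at_within)
  qed auto
  hence "((\<lambda>z. complex_of_real (z * x / (1 - z * (1 - x)))) has_integral of_real (A 1 - A 0)) {0..1}"
    by (rule has_integral_of_real)
  hence 1: "((\<lambda>z. poly 1 (of_real z) * moebius_kernel t (of_real z)) has_integral of_real (A 1 - A 0)) {0..1}"
    by (simp add: moebius_kernel_def x_def)
  have "continuous_on {0..1} (\<lambda>z. moebius_kernel t (of_real z))"
  proof -
    have "1 - complex_of_real z * (1 - of_real (exp (- t))) \<noteq> 0" if "z \<in> {0..1}" for z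
    proof -
      have "complex_of_real (1 - z * (1 - x)) \<noteq> 0" using pos[OF that] by (subst of_real_eq_0_iff) auto
      thus ?thesis by (simp add: x_def)
    qed
    thus ?thesis unfolding moebius_kernel_def by (auto intro!: continuous_intros)
  qed
  hence "set_integrable lborel {0..1} (\<lambda>z. moebius_kernel t (of_real z))"
    by (intro borel_integrable_compact[unfolded set_integrable_def[symmetric]]) auto
  hence "set_integrable lborel {0..<1} (\<lambda>z. moebius_kernel t (of_real z))"
    by (rule set_integrable_subset) auto
  hence "integrable unit_interval (\<lambda>z. poly 1 (of_real z) * moebius_kernel t (of_real z))"
    by (simp add: integrable_restrict_space set_integrable_def)
  from has_integral_unique[OF has_integral_unit_interval[OF this] 1]
  have "kernel_moment 1 t = of_real (A 1 - A 0)" by (simp add: kernel_moment_def)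
  also have "A 1 - A 0 = t * (x * (1 / (1 - x)\<^sup>2)) - x * (1 / (1 - x))"
    using x by (simp add: A_def b_def x_def power_one_over algebra_simps)
  finally have eq: "kernel_moment 1 t = of_real (t * (x * (1 / (1 - x)\<^sup>2)) - x * (1 / (1 - x)))" .
  have "(\<lambda>n. t * (x * (real (Suc n) * x ^ n)) - x * x ^ n) sums (t * (x * (1 / (1 - x)\<^sup>2)) - x * (1 / (1 - x)))"
    using x by (intro sums_diff sums_mult geometric_deriv_sums geometric_sums) auto
  also have "(\<lambda>n. t * (x * (real (Suc n) * x ^ n)) - x * x ^ n) =
     (\<lambda>n. (real (Suc n) * t - 1) * exp (- (real (Suc n) * t)))"
  proof
    fix n
    have "exp (- (real (Suc n) * t)) = x ^ Suc n"
      unfolding x_def by (subst exp_of_nat_mult[symmetric]) simp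
    thus "t * (x * (real (Suc n) * x ^ n)) - x * x ^ n = (real (Suc n) * t - 1) * exp (- (real (Suc n) * t))"
      by (simp add: algebra_simps)
  qed
  finally show ?thesis unfolding eq by (rule sums_of_real)
qed

text \<open>Termwise Mellin transformation: n \<Gamma>(s+1) / n^(s+1) - \<Gamma>(s) / n^s = (s - 1)
  \<Gamma>(s) / n^s. The factor s - 1 thus comes from the functional equation of \<Gamma>.\<close>

lemma polylog_moment_1_sums:
  assumes s: "Re s > 1"
  shows "(\<lambda>n. (s - 1) * (1 / of_nat (Suc n) powr s)) sums polylog_moment 1 s"
proof -
  have G: "Gamma s \<noteq> 0" using s by (auto simp: Gamma_eq_zero_iff elim!: nonpos_Ints_cases)
  define c where "c n = real (Suc n)" for n
  have c: "c n > 0" for n by (simp add: c_def)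
  define u where "u n t = of_real t powr (s - 1) * of_real ((c n * t - 1) * exp (- (c n * t)))" for n and t :: real
  have "has_bochner_integral halfline
      (\<lambda>t. of_real (c n) * (of_real t powr (s + 1 - 1) * of_real (exp (- (c n * t)))) -
           of_real t powr (s - 1) * of_real (exp (- (c n * t))))
      (of_real (c n) * (Gamma (s + 1) / of_real (c n) powr (s + 1)) - Gamma s / of_real (c n) powr s)" for n
    using s c by (intro has_bochner_integral_diff has_bochner_integral_mult_right has_bochner_integral_Gamma) auto
  also have "of_real (c n) * (Gamma (s + 1) / of_real (c n) powr (s + 1)) - Gamma s / of_real (c n) powr s
      = (s - 1) * Gamma s / of_real (c n) powr s" for n
  proof -
    have "s \<notin> \<int>\<^sub>\<le>\<^sub>0" using s by (auto elim!: nonpos_Ints_cases)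
    hence "Gamma (s + 1) = s * Gamma s" by (rule Gamma_plus1)
    thus ?thesis using c[of n] by (simp add: powr_add divide_simps) (simp add: algebra_simps)
  qed
  finally have u: "has_bochner_integral halfline (u n) ((s - 1) * Gamma s / of_real (c n) powr s)" for n
  proof (rule has_bochner_integral_cong[THEN iffD1, OF refl _ refl, rotated])
    fix t assume "t \<in> space halfline"
    hence "t > 0" by (auto simp: space_restrict_space)
    thus "of_real (c n) * (of_real t powr (s + 1 - 1) * of_real (exp (- (c n * t)))) -
           of_real t powr (s - 1) * of_real (exp (- (c n * t))) = u n t"
      by (simp add: u_def powr_diff field_simps)
  qed
  \<comment> \<open>Estimating the absolute value of n t - 1 by n t + 1 turns the difference of
    Gamma values into this sum; the L1 norms are then at most D / n^(Re s), which is
    summable.\<close>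
  define D where "D = Gamma (Re s + 1) + Gamma (Re s)"
  have norm_u: "(\<integral>t. norm (u n t) \<partial>halfline) \<le> D * (1 / c n powr Re s)" for n
  proof -
    let ?g = "\<lambda>t. c n * (t powr (Re s + 1 - 1) * exp (- (c n * t))) + t powr (Re s - 1) * exp (- (c n * t))"
    have g: "has_bochner_integral halfline ?g
       (c n * (Gamma (Re s + 1) / c n powr (Re s + 1)) + Gamma (Re s) / c n powr Re s)"
      using s c by (intro has_bochner_integral_add has_bochner_integral_mult_right has_bochner_integral_Gamma_real) auto
    have "(\<integral>t. norm (u n t) \<partial>halfline) \<le> integral\<^sup>L halfline ?g"
    proof (rule integral_mono)
      fix t assume "t \<in> space halfline"
      hence t: "t > 0" by (auto simp: space_restrict_space)
      have "norm (u n t) = t powr (Re s - 1) * (\<bar>c n * t - 1\<bar> * exp (- (c n * t)))"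
        using t unfolding u_def norm_mult norm_of_real by (simp add: norm_of_real_powr abs_mult)
      also have "\<dots> \<le> t powr (Re s - 1) * ((c n * t + 1) * exp (- (c n * t)))"
        using t c[of n] by (intro mult_left_mono mult_right_mono) (auto simp: abs_le_iff)
      also have "t powr (Re s - 1) = t powr Re s / t" using t by (simp add: powr_diff)
      also have "t powr Re s / t * ((c n * t + 1) * exp (- (c n * t))) =
         c n * (t powr (Re s + 1 - 1) * exp (- (c n * t))) + t powr Re s / t * exp (- (c n * t))"
        using t by (simp add: field_simps)
      also have "t powr Re s / t = t powr (Re s - 1)" using t by (simp add: powr_diff)
      finally show "norm (u n t) \<le> ?g t" .
    qed (use u g in \<open>auto simp: has_bochner_integral_iff intro: integrable_norm\<close>)
    also have "\<dots> = c n * (Gamma (Re s + 1) / c n powr (Re s + 1)) + Gamma (Re s) / c n powr Re s"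
      using g by (rule has_bochner_integral_integral_eq)
    also have "\<dots> = D * (1 / c n powr Re s)"
      using c[of n] by (simp add: D_def powr_add field_simps)
    finally show ?thesis .
  qed
  have "(\<lambda>n. integral\<^sup>L halfline (u n)) sums (\<integral>t. (\<Sum>n. u n t) \<partial>halfline)"
  proof (rule sums_integral)
    show "integrable halfline (u n)" for n using u by (auto simp: has_bochner_integral_iff)
    show "AE t in halfline. summable (\<lambda>n. norm (u n t))"
    proof (rule AE_I2)
      fix t assume "t \<in> space halfline"
      hence t: "t > 0" by (auto simp: space_restrict_space)
      define x where "x = exp (- t)"
      have x: "0 < x" "x < 1" using t by (auto simp: x_def)
      have "summable (\<lambda>n. t powr (Re s - 1) * (t * (x * (real (Suc n) * x ^ n)) + x * x ^ n))"
        using x by (intro summable_mult summable_add sums_summable[OF geometric_deriv_sums] summable_geometric) auto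
      thus "summable (\<lambda>n. norm (u n t))"
      proof (rule summable_comparison_test')
        fix n
        have e: "exp (- (c n * t)) = x ^ Suc n"
          unfolding x_def c_def by (subst exp_of_nat_mult[symmetric]) simp
        have "norm (u n t) = t powr (Re s - 1) * (\<bar>c n * t - 1\<bar> * x ^ Suc n)"
          using t x unfolding u_def norm_mult norm_of_real e by (simp add: norm_of_real_powr abs_mult)
        also have "\<dots> \<le> t powr (Re s - 1) * ((c n * t + 1) * x ^ Suc n)"
          using t x c[of n] by (intro mult_left_mono mult_right_mono) (auto simp: abs_le_iff)
        also have "(c n * t + 1) * x ^ Suc n = t * (x * (real (Suc n) * x ^ n)) + x * x ^ n"
          by (simp add: c_def algebra_simps)
        finally show "norm (norm (u n t)) \<le> t powr (Re s - 1) * (t * (x * (real (Suc n) * x ^ n)) + x * x ^ n)"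
          by simp
      qed
    qed
    have "summable (\<lambda>n. real n powr (- Re s))" using s by (simp add: summable_real_powr_iff)
    hence "summable (\<lambda>n. real (Suc n) powr (- Re s))" by (subst summable_Suc_iff)
    hence "summable (\<lambda>n. D * (1 / c n powr Re s))"
      unfolding c_def powr_minus_divide by (rule summable_mult)
    thus "summable (\<lambda>n. \<integral>t. norm (u n t) \<partial>halfline)"
      by (rule summable_comparison_test') (use norm_u in auto)
  qed
  also have "(\<integral>t. (\<Sum>n. u n t) \<partial>halfline) = (\<integral>t. of_real t powr (s - 1) * kernel_moment 1 t \<partial>halfline)"
  proof (rule Bochner_Integration.integral_cong)
    fix t assume "t \<in> space halfline"
    hence "t > 0" by (auto simp: space_restrict_space)
    from sums_unique[OF sums_mult[OF kernel_moment_1_sums[OF this], of "of_real t powr (s - 1)"]]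
    show "(\<Sum>n. u n t) = of_real t powr (s - 1) * kernel_moment 1 t"
      by (simp add: u_def c_def)
  qed auto
  also have "\<dots> = Gamma s * polylog_moment 1 s"
    using integral_unique[OF polylog_moebius_moment[OF s, of 1]] G by (simp add: polylog_moment_def)
  also have "(\<lambda>n. integral\<^sup>L halfline (u n)) = (\<lambda>n. (s - 1) * Gamma s / of_real (c n) powr s)"
    using u by (auto simp: has_bochner_integral_iff)
  finally have "(\<lambda>n. (s - 1) * Gamma s / of_real (c n) powr s / Gamma s) sums (Gamma s * polylog_moment 1 s / Gamma s)"
    by (rule sums_divide)
  thus ?thesis using G by (simp add: c_def)
qed

text \<open>The quotient \<open>polylog_moment 1 s / (s - 1)\<close> satisfies the conditions
  defining \<open>riemann_zeta\<close>. So a function with these conditions exists, the chosen one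
  has them too, and the identity theorem on the connected punctured plane makes the two
  equal.\<close>

lemma riemann_zeta_eq_polylog_moment:
  assumes "s \<noteq> 1"
  shows "(s - 1) * riemann_zeta s = polylog_moment 1 s"
proof -
  let ?P = "\<lambda>f. f holomorphic_on (- {1}) \<and>
     (\<forall>s. 1 < Re s \<longrightarrow> (\<lambda>n. 1 / of_nat (Suc n) powr s) sums f s)"
  have f: "?P (\<lambda>s. polylog_moment 1 s / (s - 1))"
  proof (intro conjI allI impI)
    have "polylog_moment 1 holomorphic_on - {1}"
      using holomorphic_on_polylog_moment by (rule holomorphic_on_subset) auto
    thus "(\<lambda>s. polylog_moment 1 s / (s - 1)) holomorphic_on - {1}"
      by (intro holomorphic_intros) auto
    show "(\<lambda>n. 1 / of_nat (Suc n) powr s) sums (polylog_moment 1 s / (s - 1))" if "1 < Re s" for s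
    proof -
      have "s \<noteq> 1" using that by auto
      thus ?thesis using sums_divide[OF polylog_moment_1_sums[OF that], of "s - 1"] by simp
    qed
  qed
  hence z: "?P riemann_zeta" unfolding riemann_zeta_def by (rule someI[of ?P])
  have "riemann_zeta s = polylog_moment 1 s / (s - 1)"
  proof (rule analytic_continuation_open[of "{s. 1 < Re s}" "- {1}" _ "\<lambda>s. polylog_moment 1 s / (s - 1)"])
    show "open {s. 1 < Re s}" by (simp add: open_halfspace_Re_gt)
    have "2 \<in> {s. 1 < Re s}" by simp
    thus "{s. 1 < Re s} \<noteq> {}" by blast
    show "connected (- {1::complex})" by (rule connected_punctured_universe) simp
    show "riemann_zeta s = polylog_moment 1 s / (s - 1)" if "s \<in> {s. 1 < Re s}" for s
      using that f z sums_unique2 by blast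
  qed (use f z assms in auto)
  thus ?thesis using assms by simp
qed

lemma has_contour_integral_polylog_unit:
  "((\<lambda>z. polylog s (z / (z - 1))) has_contour_integral - polylog_moment 1 s) (linepath 0 1)"
proof -
  have "((\<lambda>z. poly 1 (of_real z) * polylog_moebius s (of_real z)) has_integral polylog_moment 1 s) {0..1}"
    unfolding polylog_moment_def by (rule integrable_integral[OF integrable_polylog_moment])
  from has_integral_neg[OF this] show ?thesis
    by (simp add: has_contour_integral_linepath_Reals_iff polylog_moebius_def)
qed

section \<open>Taylor coefficients at 0 and termwise integration\<close>

lemma has_fps_expansion_polylog:
  "polylog s has_fps_expansion Abs_fps (\<lambda>n. if n = 0 then 0 else 1 / of_nat n powr s)"
proof (rule has_fps_expansionI)
  have "(\<lambda>n. (if n = 0 then 0 else 1 / of_nat n powr s) * w ^ n) sums polylog s w" if "norm w < 1" for w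
  proof -
    have "(\<lambda>n. (if Suc n = 0 then 0 else 1 / of_nat (Suc n) powr s) * w ^ Suc n) sums polylog s w"
      using polylog_continuation_polylog[of s] that by (simp add: polylog_continuation_def)
    thus ?thesis by (subst (asm) sums_Suc_iff) simp
  qed
  moreover have "\<forall>\<^sub>F w in nhds 0. norm (w::complex) < 1"
    using eventually_nhds_in_open[of "ball 0 1" "0::complex"] by (auto elim!: eventually_mono)
  ultimately show "\<forall>\<^sub>F w in nhds 0. (\<lambda>n. fps_nth (Abs_fps (\<lambda>n. if n = 0 then 0 else 1 / of_nat n powr s)) n * w ^ n) sums polylog s w"
    by (auto elim!: eventually_mono)
qed

text \<open>Composition of power series: z^(n+1) has the coefficient (-1)^(k+1) binom(n, k) in (z /
  (z - 1))^(k+1), and the sign in \<open>polylog_moebius\<close> absorbs one factor -1.\<close>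

lemma polylog_moebius_coeff:
  "(deriv ^^ Suc n) (polylog_moebius s) 0 / fact (Suc n) = S (Suc n) s"
proof -
  define P where "P = Abs_fps (\<lambda>n. if n = 0 then 0 else 1 / of_nat n powr s :: complex)"
  define Q :: "complex fps" where "Q = fps_X / (fps_X - 1)"
  have Qinv: "Q = - (fps_X * inverse (1 - fps_X))"
  proof -
    have "Q = fps_X * inverse (- (1 - fps_X))"
      unfolding Q_def by (subst fps_divide_unit) auto
    also have "inverse (- (1 - fps_X)) = - inverse (1 - fps_X :: complex fps)"
      by (rule fps_inverse_minus)
    finally show ?thesis by simp
  qed
  have Q: "(\<lambda>z::complex. z / (z - 1)) has_fps_expansion Q"
    unfolding Q_def by (intro fps_expansion_intros) auto
  have Qpow: "fps_nth (Q ^ Suc k) (Suc n) = (if k \<le> n then (- 1) ^ Suc k * of_nat (n choose k) else 0)" for k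
  proof -
    define A :: "complex fps" where "A = fps_X ^ Suc k * inverse ((1 - fps_const 1 * fps_X) ^ Suc k)"
    have "Q ^ Suc k = (- 1) ^ Suc k * A"
      unfolding Qinv A_def power_minus[of "_ * _"] power_mult_distrib by (simp add: fps_inverse_power[symmetric] del: power_Suc)
    also have "(- 1) ^ Suc k = fps_const ((- 1) ^ Suc k :: complex)"
      by (metis fps_const_1_eq_1 fps_const_neg fps_const_power)
    finally have "fps_nth (Q ^ Suc k) (Suc n) = (- 1) ^ Suc k * fps_nth A (Suc n)" by simp
    \<comment> \<open>After the factor \<open>fps_X ^ Suc k\<close> is removed, this is the
      coefficient of z^(n-k) in (1 - z)^(-(k+1)).\<close>
    also have "fps_nth A (Suc n) = (if k \<le> n then of_nat (n choose (n - k)) else 0)"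
      unfolding A_def fps_X_power_mult_nth by (subst one_minus_const_fps_X_neg_power') auto
    also have "\<dots> = (if k \<le> n then of_nat (n choose k) else 0)"
      by (simp add: binomial_symmetric[symmetric])
    finally show ?thesis by simp
  qed
  have "(polylog s \<circ> (\<lambda>z. z / (z - 1))) has_fps_expansion fps_compose P Q"
    unfolding P_def by (rule has_fps_expansion_compose[OF has_fps_expansion_polylog Q]) (simp add: Qinv)
  hence "polylog_moebius s has_fps_expansion - fps_compose P Q"
    by (auto intro!: has_fps_expansion_minus simp: polylog_moebius_def[abs_def] o_def)
  hence "(deriv ^^ Suc n) (polylog_moebius s) 0 / fact (Suc n) = fps_nth (- fps_compose P Q) (Suc n)"
    by (rule fps_nth_fps_expansion[symmetric])
  also have "\<dots> = - (\<Sum>i=0..Suc n. fps_nth P i * fps_nth (Q ^ i) (Suc n))"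
    by (simp add: fps_compose_nth)
  \<comment> \<open>The term for \<open>i = 0\<close> vanishes, since the polylogarithm has no
    constant term.\<close>
  also have "(\<Sum>i=0..Suc n. fps_nth P i * fps_nth (Q ^ i) (Suc n)) = 
     (\<Sum>k=0..n. fps_nth P (Suc k) * fps_nth (Q ^ Suc k) (Suc n))"
    by (subst sum.atLeast0_atMost_Suc_shift) (simp add: P_def)
  also have "\<dots> = (\<Sum>k=0..n. - ((- 1) ^ k * of_nat (n choose k) * of_nat (k + 1) powr (- s)))"
    by (intro sum.cong) (simp, simp add: P_def Qpow powr_minus_divide del: power_Suc, simp)
  finally show ?thesis by (simp add: S_def sum_negf)
qed

text \<open>The primitive \<open>h\<close> of \<open>polylog_moebius s\<close> with
  \<open>h 0 = 0\<close> is holomorphic on the unit disk, so its Taylor series converges to it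
  there. Its coefficient of index n + 2 is \<open>S (n + 1) s\<close> divided by n + 2, hence the
  series is that of \<open>Z\<close>.\<close>

lemma Z_eq_contour_integral:
  assumes x: "norm x < 1"
  shows "summable (Z_term s x)"
    and "((\<lambda>z. polylog s (z / (z - 1))) has_contour_integral - Z s x) (linepath 0 x)"
proof -
  have hol: "polylog_moebius s holomorphic_on ball 0 1"
    using holomorphic_on_polylog_moebius ball_subset_slit_plane by (rule holomorphic_on_subset)
  obtain g where g: "\<And>z. z \<in> ball 0 1 \<Longrightarrow> (g has_field_derivative polylog_moebius s z) (at z within ball 0 1)"
    using holomorphic_convex_primitive'[OF _ _ hol] by auto
  define h where "h z = g z - g 0" for z
  have h0: "h 0 = 0" by (simp add: h_def)
  have h: "(h has_field_derivative polylog_moebius s z) (at z)" if "z \<in> ball 0 1" for z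
    using g[OF that] that at_within_open[of z "ball 0 1"] unfolding h_def
    by (auto intro!: derivative_eq_intros)
  have "h holomorphic_on ball 0 1" using h by (subst holomorphic_on_open) blast+
  from holomorphic_power_series[OF this, of x]
  have series: "(\<lambda>n. (deriv ^^ n) h 0 / fact n * x ^ n) sums h x" using x by simp
  have higher: "(deriv ^^ Suc n) h 0 = (deriv ^^ n) (polylog_moebius s) 0" for n
  proof -
    have "(deriv ^^ n) (deriv h) 0 = (deriv ^^ n) (polylog_moebius s) 0"
    proof (rule higher_deriv_cong_ev)
      have "\<forall>\<^sub>F z in nhds 0. z \<in> ball (0::complex) 1" by (intro eventually_nhds_in_open) auto
      thus "\<forall>\<^sub>F z in nhds 0. deriv h z = polylog_moebius s z"
        by eventually_elim (use h DERIV_imp_deriv in blast)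
    qed auto
    thus ?thesis by (simp add: funpow_Suc_right del: funpow.simps)
  qed
  have coeff: "(deriv ^^ Suc (Suc n)) h 0 / fact (Suc (Suc n)) * x ^ Suc (Suc n) = Z_term s x n" for n
  proof -
    have "(deriv ^^ Suc (Suc n)) h 0 = S (Suc n) s * fact (Suc n)"
      unfolding higher[of "Suc n"] polylog_moebius_coeff[symmetric] by (simp del: fact_Suc funpow.simps)
    thus ?thesis
      unfolding Z_term_def fact_Suc[of "Suc n"] by (simp del: funpow.simps fact_Suc of_nat_Suc)
  qed
  \<comment> \<open>The series \<open>Z\<close> begins with x^2. The two earlier Taylor terms of
    \<open>h\<close> vanish, because \<open>h 0 = 0\<close> and because its derivative
    \<open>polylog_moebius s\<close> is 0 at 0.\<close>
  have "(\<lambda>n. (deriv ^^ Suc (Suc n)) h 0 / fact (Suc (Suc n)) * x ^ Suc (Suc n)) sums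
          (h x - (deriv ^^ 0) h 0 / fact 0 * x ^ 0 - (deriv ^^ 1) h 0 / fact 1 * x ^ 1)"
    using sums_split_initial_segment[OF series, of 2] by (simp add: numeral_2_eq_2 algebra_simps)
  also have "(deriv ^^ 1) h 0 = polylog_moebius s 0"
    using h[of 0] by (simp add: DERIV_imp_deriv)
  also have "polylog_moebius s 0 = 0"
  proof -
    have "(\<lambda>n. 0 ^ Suc n / of_nat (Suc n) powr s) sums polylog s 0"
      using polylog_continuation_polylog[of s] unfolding polylog_continuation_def by (metis norm_zero zero_less_one)
    thus ?thesis using sums_unique2[OF _ sums_zero] by (simp add: polylog_moebius_def)
  qed
  finally have "Z_term s x sums h x" unfolding coeff by (simp add: h0)
  thus "summable (Z_term s x)" by (rule sums_summable)
  have "Z s x = h x" using \<open>Z_term s x sums h x\<close> by (simp add: Z_def sums_iff)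
  have "(polylog_moebius s has_contour_integral (h (pathfinish (linepath 0 x)) - h (pathstart (linepath 0 x)))) (linepath 0 x)"
  proof (rule contour_integral_primitive[where S = "ball 0 1"])
    show "path_image (linepath 0 x) \<subseteq> ball 0 1"
      unfolding path_image_linepath using x by (intro closed_segment_subset) auto
    show "(h has_field_derivative polylog_moebius s z) (at z within ball 0 1)" if "z \<in> ball 0 1" for z
      using h[OF that] by (rule has_field_derivative_at_within)
  qed (rule valid_path_linepath)
  from has_contour_integral_neg[OF this]
  show "((\<lambda>z. polylog s (z / (z - 1))) has_contour_integral - Z s x) (linepath 0 x)"
    by (simp add: polylog_moebius_def \<open>Z s x = h x\<close> h_def)
qed

theorem theorem3p2:
  fixes s :: complex
  shows
    "(\<lambda>z. polylog s (z / (z - 1))) contour_integrable_on linepath 0 1 \<and>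
     (s \<noteq> 1 \<longrightarrow>
        (s - 1) * riemann_zeta s =
          - contour_integral (linepath 0 1) (\<lambda>z. polylog s (z / (z - 1)))) \<and>
     (s = 1 \<longrightarrow>
        ((\<lambda>u. (u - 1) * riemann_zeta u) \<longlongrightarrow>
          - contour_integral (linepath 0 1) (\<lambda>z. polylog s (z / (z - 1)))) (at s)) \<and>
     (\<forall>x::complex. norm x < 1 \<longrightarrow>
        summable (Z_term s x) \<and>
        (\<lambda>z. polylog s (z / (z - 1))) contour_integrable_on linepath 0 x \<and>
        Z s x = - contour_integral (linepath 0 x) (\<lambda>z. polylog s (z / (z - 1))))"
proof -
  have int1: "- contour_integral (linepath 0 1) (\<lambda>z. polylog s (z / (z - 1))) = polylog_moment 1 s"
    using contour_integral_unique[OF has_contour_integral_polylog_unit[of s]] by simp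
  \<comment> \<open>At the pole the value of \<open>riemann_zeta\<close> is arbitrary, so the
    product is taken as a limit; it exists because the product agrees off the pole with the entire
    function \<open>polylog_moment 1\<close>.\<close>
  have lim: "((\<lambda>u. (u - 1) * riemann_zeta u) \<longlongrightarrow> polylog_moment 1 s) (at s)" if "s = 1"
  proof -
    have "isCont (polylog_moment 1) s"
      using holomorphic_on_imp_continuous_on[OF holomorphic_on_polylog_moment[of 1]]
      by (simp add: continuous_on_eq_continuous_at)
    hence "(polylog_moment 1 \<longlongrightarrow> polylog_moment 1 s) (at s)" by (simp add: isCont_def)
    moreover have "\<forall>\<^sub>F u in at s. polylog_moment 1 u = (u - 1) * riemann_zeta u"
      using that riemann_zeta_eq_polylog_moment by (auto simp: eventually_at_filter)
    ultimately show ?thesis by (rule Lim_transform_eventually)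
  qed
  show ?thesis
    unfolding int1
    using has_contour_integral_polylog_unit[of s] riemann_zeta_eq_polylog_moment[of s] lim
      Z_eq_contour_integral[of _ s] contour_integral_unique[OF Z_eq_contour_integral(2)[of _ s]]
    by (auto simp: contour_integrable_on_def)
qed

end
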